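(* Let $G$ be a group. Every braided $G$-crossed category is equivalent to a strict braided $G$-crossed category. That is, for every braided $G$-crossed monoidal category $\mathcal{C}$ there exists a strict braided $G$-crossed monoidal category $\mathcal{D}$ such that $\mathcal{C}$ and $\mathcal{D}$ are equivalent as braided $G$-crossed monoidal categories.
   Context: Convention: "monoidal category" means strict monoidal category; the unit object is denoted $\mathbf{1}$. A monoidal functor $(F,F_2,F_0):\mathcal{C}\to\mathcal{D}$ consists of a functor $F$, natural isomorphisms $F_2(X,Y):F(X\otimes Y)\to F(X)\otimes F(Y)$ and an isomorphism $F_0:F(\mathbf{1})\to\mathbf{1}$ satisfying $(F_2(X,Y)\otimes \mathrm{id}_{F(Z)})F_2(X\otimes Y,Z)=(\mathrm{id}_{F(X)}\otimes F_2(Y,Z))F_2(X,Y\otimes Z)$ and $(\mathrm{id}_{F(X)}\otimes F_0)F_2(X,\mathbf{1})=\mathrm{id}_{F(X)}=(F_0\otimes \mathrm{id}_{F(X)})F_2(\mathbf{1},X)$. Monoidal natural transformations are natural transformations compatible with $F_2$ and $F_0$. The composite $GF$ of monoidal functors has $(GF)_2(X,Y)=G_2(F(X),F(Y))\,G(F_2(X,Y))$ and $(GF)_0=G_0\,G(F_0)$. A monoidal $G$-category is a monoidal category $\mathcal{C}$ together with: functors $g_*:\mathcal{C}\to\mathcal{C}$ for $g\in G$; natural isomorphisms $\phi(g,h):(gh)_*\to g_*\circ h_*$ for $g,h\in G$; natural isomorphisms $\psi^g(X,Y):g_*(X\otimes Y)\to g_*(X)\otimes g_*(Y)$ for $g\in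 G$; such that $g_*(\mathbf{1})=\mathbf{1}$, $\psi^g(X,\mathbf{1})=\psi^g(\mathbf{1},X)=\mathrm{id}_{g_*(X)}$, $e_*=\mathrm{Id}_{\mathcal{C}}$, $\phi(e,g)=\phi(g,e)=\mathrm{Id}_{g_*}$, and for all $g,h,k\in G$ and objects $X,Y,Z$: - $\phi(g,h)_{k_*(X)}\circ\phi(gh,k)_X=g_*(\phi(h,k)_X)\circ\phi(g,hk)_X$; - $(\psi^g(X,Y)\otimes \mathrm{id}_{g_*(Z)})\circ\psi^g(X\otimes Y,Z)=(\mathrm{id}_{g_*(X)}\otimes\psi^g(Y,Z))\circ\psi^g(X,Y\otimes Z)$; - $(\phi(g,h)_X\otimes\phi(g,h)_Y)\circ\psi^{gh}(X,Y)=\psi^g(h_*(X),h_*(Y))\circ g_*(\psi^h(X,Y))\circ\phi(g,h)_{X\otimes Y}$. It is strict if all $\psi^g$ and all $\phi(g,h)$ are identities. A monoidal $G$-functor $(F,\eta):\mathcal{C}\to\mathcal{D}$ is a monoidal functor $F$ with monoidal natural isomorphisms $\eta(g):g_*\circ F\to F\circ g_*$ ($g\in G$) such that $\eta(e)=\mathrm{Id}_F$ and $F(\phi(g,h)_X)\circ\eta(gh)_X=\eta(g)_{h_*(X)}\circ g_*(\eta(h)_X)\circ\phi(g,h)_{F(X)}$ for all $g,h\in G$ and all objects $X$. A $G$-graded monoidal category is a monoidal category $\mathcal{C}$ with a decomposition $\mathcal{C}=\coprod_{g\in G}\mathcal{C}_g$ (coproduct of categories; if $k$ is a commutative ring and $\mathcal{C}$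 is $k$-linear abelian, the coproduct is taken among $k$-linear abelian categories) such that $\mathbf{1}\in\mathcal{C}_e$ and $\mathcal{C}_g\otimes\mathcal{C}_h\subset\mathcal{C}_{gh}$ for all $g,h$. A $G$-crossed monoidal category is a $G$-graded monoidal category with a structure of monoidal $G$-category such that $g_*(\mathcal{C}_h)\subset\mathcal{C}_{ghg^{-1}}$ for all $g,h\in G$. A $G$-braiding on a $G$-crossed monoidal category $\mathcal{C}$ is a family of isomorphisms $c_{X,Y}:X\otimes Y\to g_*(Y)\otimes X$ (for $g\in G$, $X\in\mathcal{C}_g$, $Y\in\mathcal{C}$), natural in $X$ and $Y$, such that: - for $g,h\in G$, $X\in\mathcal{C}_h$, $Z\in\mathcal{C}$: $\psi^g(h_*(Z),X)\circ g_*(c_{X,Z})=(\phi(g,h)_Z\otimes\mathrm{id}_{g_*(X)})\circ(\phi(ghg^{-1},g)_Z^{-1}\otimes\mathrm{id}_{g_*(X)})\circ c_{g_*(X),g_*(Z)}\circ\psi^g(X,Z)$; - for $X\in\mathcal{C}_g$, $Y,Z\in\mathcal{C}$: $(\psi^g(Y,Z)\otimes\mathrm{id}_X)\circ c_{X,Y\otimes Z}=(\mathrm{id}_{g_*(Y)}\otimes c_{X,Z})\circ(c_{X,Y}\otimes\mathrm{id}_Z)$; - for $X\in\mathcal{C}_g$, $Y\in\mathcal{C}_h$, $Z\in\mathcal{C}$: $(\phi(g,h)_Z\otimes\mathrm{id}_{X\otimes Y})\circ c_{X\otimes Y,Z}=(c_{X,h_*(Z)}\otimes\mathrm{id}_Y)\circ(\mathrm{id}_X\otimes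 c_{Y,Z})$. A braided $G$-crossed (monoidal) category is a $G$-crossed monoidal category with a $G$-braiding; it is strict if it is strict as a monoidal $G$-category. A functor of braided $G$-crossed monoidal categories is a monoidal $G$-functor $(F,\eta):\mathcal{C}\to\mathcal{D}$ with $F(\mathcal{C}_g)\subset\mathcal{D}_g$ for all $g$ and $F_2(g_*(Y),X)\circ F(c_{X,Y})=(\eta(g)_Y\otimes\mathrm{id}_{F(X)})\circ c_{F(X),F(Y)}\circ F_2(X,Y)$ for all $g\in G$, $X\in\mathcal{C}_g$, $Y\in\mathcal{C}$. It is an equivalence of braided $G$-crossed monoidal categories if $F$ is an equivalence of categories; $\mathcal{C}$ and $\mathcal{D}$ are equivalent if such an equivalence between them exists. *)

theory Defs
  imports "HOL-Algebra.Module"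
begin

section \<open>Categories, functors, natural isomorphisms\<close>

text \<open>
  Total HOL functions stand for partial operations: \<open>Dom\<close>, \<open>Cod\<close>, \<open>Comp\<close> and so on are only
  constrained on \<open>Obj\<close>, \<open>Arr\<close> and composable pairs.  Composition is written in the usual
  (right-to-left) order.
\<close>

record ('o, 'm) category =
  Obj :: "'o set"
  Arr :: "'m set"
  Dom :: "'m \<Rightarrow> 'o"
  Cod :: "'m \<Rightarrow> 'o"
  ident :: "'o \<Rightarrow> 'm" (\<open>\<iota>\<index>\<close>)
  Comp :: "'m \<Rightarrow> 'm \<Rightarrow> 'm" (infixr \<open>\<cdot>\<index>\<close> 70)

definition Hom :: "('o, 'm, 'z) category_scheme \<Rightarrow> 'o \<Rightarrow> 'o \<Rightarrow> 'm set" where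
  "Hom C X Y = {f \<in> Arr C. Dom C f = X \<and> Cod C f = Y}"

locale category =
  fixes C (structure)
  assumes Dom_in_Obj: "f \<in> Arr C \<Longrightarrow> Dom C f \<in> Obj C"
    and Cod_in_Obj: "f \<in> Arr C \<Longrightarrow> Cod C f \<in> Obj C"
    and ident_in_Hom: "X \<in> Obj C \<Longrightarrow> \<iota> X \<in> Hom C X X"
    and Comp_in_Hom: "\<lbrakk>f \<in> Hom C X Y; g \<in> Hom C Y Z\<rbrakk> \<Longrightarrow> g \<cdot> f \<in> Hom C X Z"
    and Comp_ident_right: "f \<in> Hom C X Y \<Longrightarrow> f \<cdot> \<iota> X = f"
    and Comp_ident_left: "f \<in> Hom C X Y \<Longrightarrow> \<iota> Y \<cdot> f = f"
    and Comp_assoc: "\<lbrakk>f \<in> Hom C W X; g \<in> Hom C X Y; h \<in> Hom C Y Z\<rbrakk>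
          \<Longrightarrow> (h \<cdot> g) \<cdot> f = h \<cdot> (g \<cdot> f)"

definition inverse_arrows :: "('o, 'm, 'z) category_scheme \<Rightarrow> 'm \<Rightarrow> 'm \<Rightarrow> bool" where
  "inverse_arrows C f g \<longleftrightarrow> f \<in> Arr C \<and> g \<in> Hom C (Cod C f) (Dom C f)
     \<and> g \<cdot>\<^bsub>C\<^esub> f = \<iota>\<^bsub>C\<^esub> (Dom C f) \<and> f \<cdot>\<^bsub>C\<^esub> g = \<iota>\<^bsub>C\<^esub> (Cod C f)"

definition is_iso :: "('o, 'm, 'z) category_scheme \<Rightarrow> 'm \<Rightarrow> bool" where
  "is_iso C f \<longleftrightarrow> (\<exists>g. inverse_arrows C f g)"

definition inv_arrow :: "('o, 'm, 'z) category_scheme \<Rightarrow> 'm \<Rightarrow> 'm" where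
  "inv_arrow C f = (THE g. inverse_arrows C f g)"

definition full_subcat :: "('o, 'm, 'z) category_scheme \<Rightarrow> 'o set \<Rightarrow> ('o, 'm, 'z) category_scheme" where
  "full_subcat C S = C\<lparr>Obj := Obj C \<inter> S, Arr := {f \<in> Arr C. Dom C f \<in> S \<and> Cod C f \<in> S}\<rparr>"

record ('o, 'm, 'p, 'n) Functor =
  FObj :: "'o \<Rightarrow> 'p"
  FArr :: "'m \<Rightarrow> 'n"

definition is_functor ::
  "('o, 'm, 'y) category_scheme \<Rightarrow> ('p, 'n, 'z) category_scheme
    \<Rightarrow> ('o, 'm, 'p, 'n, 'w) Functor_scheme \<Rightarrow> bool" where
  "is_functor C D F \<longleftrightarrow>
     (\<forall>X \<in> Obj C. FObj F X \<in> Obj D)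
     \<and> (\<forall>f \<in> Arr C. FArr F f \<in> Hom D (FObj F (Dom C f)) (FObj F (Cod C f)))
     \<and> (\<forall>X \<in> Obj C. FArr F (\<iota>\<^bsub>C\<^esub> X) = \<iota>\<^bsub>D\<^esub> (FObj F X))
     \<and> (\<forall>f \<in> Arr C. \<forall>g \<in> Arr C. Dom C g = Cod C f \<longrightarrow>
           FArr F (g \<cdot>\<^bsub>C\<^esub> f) = FArr F g \<cdot>\<^bsub>D\<^esub> FArr F f)"

definition id_functor :: "('o, 'm, 'o, 'm) Functor" where
  "id_functor = \<lparr>FObj = (\<lambda>X. X), FArr = (\<lambda>f. f)\<rparr>"

definition comp_functor ::
  "('p, 'n, 'q, 'l, 'y) Functor_scheme \<Rightarrow> ('o, 'm, 'p, 'n, 'z) Functor_scheme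
    \<Rightarrow> ('o, 'm, 'q, 'l) Functor" where
  "comp_functor K F = \<lparr>FObj = FObj K \<circ> FObj F, FArr = FArr K \<circ> FArr F\<rparr>"

definition natural_iso ::
  "('o, 'm, 'y) category_scheme \<Rightarrow> ('p, 'n, 'z) category_scheme
    \<Rightarrow> ('o, 'm, 'p, 'n, 'v) Functor_scheme \<Rightarrow> ('o, 'm, 'p, 'n, 'w) Functor_scheme
    \<Rightarrow> ('o \<Rightarrow> 'n) \<Rightarrow> bool" where
  "natural_iso C D F F' \<alpha> \<longleftrightarrow>
     (\<forall>X \<in> Obj C. \<alpha> X \<in> Hom D (FObj F X) (FObj F' X) \<and> is_iso D (\<alpha> X))
     \<and> (\<forall>f \<in> Arr C. \<alpha> (Cod C f) \<cdot>\<^bsub>D\<^esub> FArr F f = FArr F' f \<cdot>\<^bsub>D\<^esub> \<alpha> (Dom C f))"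

definition is_equivalence ::
  "('o, 'm, 'y) category_scheme \<Rightarrow> ('p, 'n, 'z) category_scheme
    \<Rightarrow> ('o, 'm, 'p, 'n, 'w) Functor_scheme \<Rightarrow> bool" where
  "is_equivalence C D F \<longleftrightarrow> is_functor C D F \<and>
     (\<exists>K :: ('p, 'n, 'o, 'm) Functor. is_functor D C K
        \<and> (\<exists>\<alpha>. natural_iso C C (comp_functor K F) id_functor \<alpha>)
        \<and> (\<exists>\<beta>. natural_iso D D (comp_functor F K) id_functor \<beta>))"


section \<open>Strict monoidal categories and monoidal functors\<close>

record ('o, 'm) monoidal_category = "('o, 'm) category" +
  tensor_obj :: "'o \<Rightarrow> 'o \<Rightarrow> 'o" (infixl \<open>\<otimes>\<^sub>o\<index>\<close> 75)
  tensor_arr :: "'m \<Rightarrow> 'm \<Rightarrow> 'm" (infixl \<open>\<otimes>\<^sub>a\<index>\<close> 75)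
  unit_obj :: "'o" (\<open>\<I>\<index>\<close>)

locale monoidal_category = category +
  assumes unit_in_Obj: "\<I> \<in> Obj C"
    and tensor_obj_closed: "\<lbrakk>X \<in> Obj C; Y \<in> Obj C\<rbrakk> \<Longrightarrow> X \<otimes>\<^sub>o Y \<in> Obj C"
    and tensor_arr_in_Hom: "\<lbrakk>f \<in> Hom C X X'; g \<in> Hom C Y Y'\<rbrakk>
          \<Longrightarrow> f \<otimes>\<^sub>a g \<in> Hom C (X \<otimes>\<^sub>o Y) (X' \<otimes>\<^sub>o Y')"
    and tensor_ident: "\<lbrakk>X \<in> Obj C; Y \<in> Obj C\<rbrakk> \<Longrightarrow> \<iota> X \<otimes>\<^sub>a \<iota> Y = \<iota> (X \<otimes>\<^sub>o Y)"
    and tensor_Comp: "\<lbrakk>f \<in> Hom C X X'; f' \<in> Hom C X' X''; g \<in> Hom C Y Y'; g' \<in> Hom C Y' Y''\<rbrakk>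
          \<Longrightarrow> (f' \<cdot> f) \<otimes>\<^sub>a (g' \<cdot> g) = (f' \<otimes>\<^sub>a g') \<cdot> (f \<otimes>\<^sub>a g)"
    and tensor_obj_assoc: "\<lbrakk>X \<in> Obj C; Y \<in> Obj C; Z \<in> Obj C\<rbrakk>
          \<Longrightarrow> (X \<otimes>\<^sub>o Y) \<otimes>\<^sub>o Z = X \<otimes>\<^sub>o (Y \<otimes>\<^sub>o Z)"
    and tensor_arr_assoc: "\<lbrakk>f \<in> Arr C; g \<in> Arr C; h \<in> Arr C\<rbrakk>
          \<Longrightarrow> (f \<otimes>\<^sub>a g) \<otimes>\<^sub>a h = f \<otimes>\<^sub>a (g \<otimes>\<^sub>a h)"
    and tensor_obj_unit: "X \<in> Obj C \<Longrightarrow> \<I> \<otimes>\<^sub>o X = X" "X \<in> Obj C \<Longrightarrow> X \<otimes>\<^sub>o \<I> = X"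
    and tensor_arr_unit: "f \<in> Arr C \<Longrightarrow> \<iota> \<I> \<otimes>\<^sub>a f = f" "f \<in> Arr C \<Longrightarrow> f \<otimes>\<^sub>a \<iota> \<I> = f"

text \<open>
  \<open>tensor_comparison C D F \<mu>\<close>: the family \<open>\<mu> X Y : F (X \<otimes> Y) \<rightarrow> F X \<otimes> F Y\<close> consists of isomorphisms,
  is natural in both variables and satisfies the associativity constraint of a monoidal functor.
\<close>

definition tensor_comparison ::
  "('o, 'm, 'y) monoidal_category_scheme \<Rightarrow> ('p, 'n, 'z) monoidal_category_scheme
    \<Rightarrow> ('o, 'm, 'p, 'n, 'w) Functor_scheme \<Rightarrow> ('o \<Rightarrow> 'o \<Rightarrow> 'n) \<Rightarrow> bool" where
  "tensor_comparison C D F \<mu> \<longleftrightarrow>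
     (\<forall>X \<in> Obj C. \<forall>Y \<in> Obj C.
        \<mu> X Y \<in> Hom D (FObj F (X \<otimes>\<^sub>o\<^bsub>C\<^esub> Y)) (FObj F X \<otimes>\<^sub>o\<^bsub>D\<^esub> FObj F Y) \<and> is_iso D (\<mu> X Y))
     \<and> (\<forall>f \<in> Arr C. \<forall>g \<in> Arr C.
          \<mu> (Cod C f) (Cod C g) \<cdot>\<^bsub>D\<^esub> FArr F (f \<otimes>\<^sub>a\<^bsub>C\<^esub> g)
          = (FArr F f \<otimes>\<^sub>a\<^bsub>D\<^esub> FArr F g) \<cdot>\<^bsub>D\<^esub> \<mu> (Dom C f) (Dom C g))
     \<and> (\<forall>X \<in> Obj C. \<forall>Y \<in> Obj C. \<forall>Z \<in> Obj C.
          (\<mu> X Y \<otimes>\<^sub>a\<^bsub>D\<^esub> \<iota>\<^bsub>D\<^esub> (FObj F Z)) \<cdot>\<^bsub>D\<^esub> \<mu> (X \<otimes>\<^sub>o\<^bsub>C\<^esub> Y) Z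
          = (\<iota>\<^bsub>D\<^esub> (FObj F X) \<otimes>\<^sub>a\<^bsub>D\<^esub> \<mu> Y Z) \<cdot>\<^bsub>D\<^esub> \<mu> X (Y \<otimes>\<^sub>o\<^bsub>C\<^esub> Z))"

record ('o, 'm, 'p, 'n) mon_Functor = "('o, 'm, 'p, 'n) Functor" +
  F2 :: "'o \<Rightarrow> 'o \<Rightarrow> 'n"
  F0 :: "'n"

definition monoidal_functor ::
  "('o, 'm, 'y) monoidal_category_scheme \<Rightarrow> ('p, 'n, 'z) monoidal_category_scheme
    \<Rightarrow> ('o, 'm, 'p, 'n) mon_Functor \<Rightarrow> bool" where
  "monoidal_functor C D F \<longleftrightarrow>
     is_functor C D F
     \<and> tensor_comparison C D F (F2 F)
     \<and> F0 F \<in> Hom D (FObj F \<I>\<^bsub>C\<^esub>) \<I>\<^bsub>D\<^esub> \<and> is_iso D (F0 F)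
     \<and> (\<forall>X \<in> Obj C.
          (\<iota>\<^bsub>D\<^esub> (FObj F X) \<otimes>\<^sub>a\<^bsub>D\<^esub> F0 F) \<cdot>\<^bsub>D\<^esub> F2 F X \<I>\<^bsub>C\<^esub> = \<iota>\<^bsub>D\<^esub> (FObj F X)
          \<and> (F0 F \<otimes>\<^sub>a\<^bsub>D\<^esub> \<iota>\<^bsub>D\<^esub> (FObj F X)) \<cdot>\<^bsub>D\<^esub> F2 F \<I>\<^bsub>C\<^esub> X = \<iota>\<^bsub>D\<^esub> (FObj F X))"

text \<open>The first argument \<open>E\<close> is the target category of the composite.\<close>

definition comp_mon_functor ::
  "('q, 'l, 'z) monoidal_category_scheme \<Rightarrow> ('p, 'n, 'q, 'l) mon_Functor
    \<Rightarrow> ('o, 'm, 'p, 'n) mon_Functor \<Rightarrow> ('o, 'm, 'q, 'l) mon_Functor" where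
  "comp_mon_functor E K F =
     \<lparr>FObj = FObj K \<circ> FObj F,
      FArr = FArr K \<circ> FArr F,
      F2 = (\<lambda>X Y. F2 K (FObj F X) (FObj F Y) \<cdot>\<^bsub>E\<^esub> FArr K (F2 F X Y)),
      F0 = F0 K \<cdot>\<^bsub>E\<^esub> FArr K (F0 F)\<rparr>"

definition monoidal_natural_iso ::
  "('o, 'm, 'y) monoidal_category_scheme \<Rightarrow> ('p, 'n, 'z) monoidal_category_scheme
    \<Rightarrow> ('o, 'm, 'p, 'n) mon_Functor \<Rightarrow> ('o, 'm, 'p, 'n) mon_Functor \<Rightarrow> ('o \<Rightarrow> 'n) \<Rightarrow> bool" where
  "monoidal_natural_iso C D F F' \<alpha> \<longleftrightarrow>
     natural_iso C D F F' \<alpha>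
     \<and> (\<forall>X \<in> Obj C. \<forall>Y \<in> Obj C.
          (\<alpha> X \<otimes>\<^sub>a\<^bsub>D\<^esub> \<alpha> Y) \<cdot>\<^bsub>D\<^esub> F2 F X Y = F2 F' X Y \<cdot>\<^bsub>D\<^esub> \<alpha> (X \<otimes>\<^sub>o\<^bsub>C\<^esub> Y))
     \<and> F0 F' \<cdot>\<^bsub>D\<^esub> \<alpha> \<I>\<^bsub>C\<^esub> = F0 F"


section \<open>Monoidal G-categories and monoidal G-functors\<close>

text \<open>
  One record carries all the data of a braided \<open>G\<close>-crossed category.  \<open>deg g\<close> is the set of objects
  of \<open>C\<^sub>g\<close>, and \<open>braid g X Y\<close> is \<open>c\<^sub>X\<^sub>,\<^sub>Y\<close> for \<open>X\<close> regarded as an object of \<open>C\<^sub>g\<close>; the index \<open>g\<close> is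
  needed because in the linear case a zero object may lie in several components.
\<close>

record ('g, 'o, 'm) crossed_category = "('o, 'm) monoidal_category" +
  act_obj :: "'g \<Rightarrow> 'o \<Rightarrow> 'o"
  act_arr :: "'g \<Rightarrow> 'm \<Rightarrow> 'm"
  phi :: "'g \<Rightarrow> 'g \<Rightarrow> 'o \<Rightarrow> 'm"
  psi :: "'g \<Rightarrow> 'o \<Rightarrow> 'o \<Rightarrow> 'm"
  deg :: "'g \<Rightarrow> 'o set"
  braid :: "'g \<Rightarrow> 'o \<Rightarrow> 'o \<Rightarrow> 'm"

text \<open>The monoidal functor \<open>(g\<^sub>*, \<psi>\<^sup>g, id)\<close>.\<close>

definition act :: "('g, 'o, 'm, 'z) crossed_category_scheme \<Rightarrow> 'g \<Rightarrow> ('o, 'm, 'o, 'm) mon_Functor" where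
  "act C g = \<lparr>FObj = act_obj C g, FArr = act_arr C g, F2 = psi C g, F0 = \<iota>\<^bsub>C\<^esub> \<I>\<^bsub>C\<^esub>\<rparr>"

locale monoidal_G_category = monoidal_category C + group G
  for G and C (structure) +
  assumes act_functor: "g \<in> carrier G \<Longrightarrow> is_functor C C (act C g)"
    and phi_natural: "\<lbrakk>g \<in> carrier G; h \<in> carrier G\<rbrakk>
          \<Longrightarrow> natural_iso C C (act C (g \<otimes>\<^bsub>G\<^esub> h)) (comp_functor (act C g) (act C h)) (phi C g h)"
    and psi_comparison: "g \<in> carrier G \<Longrightarrow> tensor_comparison C C (act C g) (psi C g)"
    and act_unit: "g \<in> carrier G \<Longrightarrow> act_obj C g \<I> = \<I>"
    and psi_unit_right: "\<lbrakk>g \<in> carrier G; X \<in> Obj C\<rbrakk> \<Longrightarrow> psi C g X \<I> = \<iota> (act_obj C g X)"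
    and psi_unit_left: "\<lbrakk>g \<in> carrier G; X \<in> Obj C\<rbrakk> \<Longrightarrow> psi C g \<I> X = \<iota> (act_obj C g X)"
    and act_one_obj: "X \<in> Obj C \<Longrightarrow> act_obj C \<one>\<^bsub>G\<^esub> X = X"
    and act_one_arr: "f \<in> Arr C \<Longrightarrow> act_arr C \<one>\<^bsub>G\<^esub> f = f"
    and phi_one_left: "\<lbrakk>g \<in> carrier G; X \<in> Obj C\<rbrakk> \<Longrightarrow> phi C \<one>\<^bsub>G\<^esub> g X = \<iota> (act_obj C g X)"
    and phi_one_right: "\<lbrakk>g \<in> carrier G; X \<in> Obj C\<rbrakk> \<Longrightarrow> phi C g \<one>\<^bsub>G\<^esub> X = \<iota> (act_obj C g X)"
    and phi_assoc: "\<lbrakk>g \<in> carrier G; h \<in> carrier G; k \<in> carrier G; X \<in> Obj C\<rbrakk>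
          \<Longrightarrow> phi C g h (act_obj C k X) \<cdot> phi C (g \<otimes>\<^bsub>G\<^esub> h) k X
            = act_arr C g (phi C h k X) \<cdot> phi C g (h \<otimes>\<^bsub>G\<^esub> k) X"
    and phi_psi: "\<lbrakk>g \<in> carrier G; h \<in> carrier G; X \<in> Obj C; Y \<in> Obj C\<rbrakk>
          \<Longrightarrow> (phi C g h X \<otimes>\<^sub>a phi C g h Y) \<cdot> psi C (g \<otimes>\<^bsub>G\<^esub> h) X Y
            = psi C g (act_obj C h X) (act_obj C h Y) \<cdot> act_arr C g (psi C h X Y)
                \<cdot> phi C g h (X \<otimes>\<^sub>o Y)"

text \<open>
  All \<open>\<psi>\<^sup>g\<close> and \<open>\<phi>(g,h)\<close> are identity transformations.  For a monoidal \<open>G\<close>-category the equations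
  below also force \<open>(gh)\<^sub>* = g\<^sub>* h\<^sub>*\<close> and \<open>g\<^sub>*(X \<otimes> Y) = g\<^sub>* X \<otimes> g\<^sub>* Y\<close>, on objects by comparing
  codomains and on arrows by naturality.
\<close>

definition strict_action ::
  "('g, 'x) monoid_scheme \<Rightarrow> ('g, 'o, 'm, 'z) crossed_category_scheme \<Rightarrow> bool" where
  "strict_action G C \<longleftrightarrow>
     (\<forall>g \<in> carrier G. \<forall>X \<in> Obj C. \<forall>Y \<in> Obj C.
        psi C g X Y = \<iota>\<^bsub>C\<^esub> (act_obj C g (X \<otimes>\<^sub>o\<^bsub>C\<^esub> Y)))
     \<and> (\<forall>g \<in> carrier G. \<forall>h \<in> carrier G. \<forall>X \<in> Obj C.
          phi C g h X = \<iota>\<^bsub>C\<^esub> (act_obj C (g \<otimes>\<^bsub>G\<^esub> h) X))"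

definition monoidal_G_functor ::
  "('g, 'x) monoid_scheme \<Rightarrow> ('g, 'o, 'm, 'y) crossed_category_scheme
    \<Rightarrow> ('g, 'p, 'n, 'z) crossed_category_scheme
    \<Rightarrow> ('o, 'm, 'p, 'n) mon_Functor \<Rightarrow> ('g \<Rightarrow> 'o \<Rightarrow> 'n) \<Rightarrow> bool" where
  "monoidal_G_functor G C D F \<eta> \<longleftrightarrow>
     monoidal_functor C D F
     \<and> (\<forall>g \<in> carrier G. monoidal_natural_iso C D
          (comp_mon_functor D (act D g) F) (comp_mon_functor D F (act C g)) (\<eta> g))
     \<and> (\<forall>X \<in> Obj C. \<eta> \<one>\<^bsub>G\<^esub> X = \<iota>\<^bsub>D\<^esub> (FObj F X))
     \<and> (\<forall>g \<in> carrier G. \<forall>h \<in> carrier G. \<forall>X \<in> Obj C.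
          FArr F (phi C g h X) \<cdot>\<^bsub>D\<^esub> \<eta> (g \<otimes>\<^bsub>G\<^esub> h) X
          = \<eta> g (act_obj C h X) \<cdot>\<^bsub>D\<^esub> act_arr D g (\<eta> h X) \<cdot>\<^bsub>D\<^esub> phi D g h (FObj F X))"


section \<open>Linear and abelian categories\<close>

text \<open>
  A \<open>k\<close>-linear structure on \<open>C\<close> is a family \<open>H\<close> of \<open>k\<close>-modules, \<open>H X Y\<close> having \<open>Hom C X Y\<close> as
  carrier.  Only the additive part of the record \<open>H X Y\<close> is used; its multiplicative fields are
  irrelevant.
\<close>

locale linear_category = category C + cring k
  for k and C (structure) and H :: "'o \<Rightarrow> 'o \<Rightarrow> ('k, 'm) module" +
  assumes Hom_module: "\<lbrakk>X \<in> Obj C; Y \<in> Obj C\<rbrakk> \<Longrightarrow> module k (H X Y)"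
    and carrier_Hom: "\<lbrakk>X \<in> Obj C; Y \<in> Obj C\<rbrakk> \<Longrightarrow> carrier (H X Y) = Hom C X Y"
    and Comp_add_left: "\<lbrakk>f \<in> Hom C X Y; g \<in> Hom C Y Z; g' \<in> Hom C Y Z\<rbrakk>
          \<Longrightarrow> (g \<oplus>\<^bsub>H Y Z\<^esub> g') \<cdot> f = (g \<cdot> f) \<oplus>\<^bsub>H X Z\<^esub> (g' \<cdot> f)"
    and Comp_add_right: "\<lbrakk>f \<in> Hom C X Y; f' \<in> Hom C X Y; g \<in> Hom C Y Z\<rbrakk>
          \<Longrightarrow> g \<cdot> (f \<oplus>\<^bsub>H X Y\<^esub> f') = (g \<cdot> f) \<oplus>\<^bsub>H X Z\<^esub> (g \<cdot> f')"
    and Comp_smult_left: "\<lbrakk>a \<in> carrier k; f \<in> Hom C X Y; g \<in> Hom C Y Z\<rbrakk>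
          \<Longrightarrow> (a \<odot>\<^bsub>H Y Z\<^esub> g) \<cdot> f = a \<odot>\<^bsub>H X Z\<^esub> (g \<cdot> f)"
    and Comp_smult_right: "\<lbrakk>a \<in> carrier k; f \<in> Hom C X Y; g \<in> Hom C Y Z\<rbrakk>
          \<Longrightarrow> g \<cdot> (a \<odot>\<^bsub>H X Y\<^esub> f) = a \<odot>\<^bsub>H X Z\<^esub> (g \<cdot> f)"

definition zero_object :: "('o, 'm, 'z) category_scheme \<Rightarrow> 'o \<Rightarrow> bool" where
  "zero_object C Z \<longleftrightarrow> Z \<in> Obj C \<and> (\<forall>X \<in> Obj C. (\<exists>!f. f \<in> Hom C X Z) \<and> (\<exists>!f. f \<in> Hom C Z X))"

text \<open>\<open>P\<close> is a direct sum (biproduct) of the finite family \<open>(Y i)\<^sub>i\<^sub>\<in>\<^sub>I\<close>.\<close>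

definition direct_sum ::
  "('o, 'm, 'z) category_scheme \<Rightarrow> ('o \<Rightarrow> 'o \<Rightarrow> ('k, 'm) module)
    \<Rightarrow> 'i set \<Rightarrow> ('i \<Rightarrow> 'o) \<Rightarrow> 'o \<Rightarrow> bool" where
  "direct_sum C H I Y P \<longleftrightarrow> finite I \<and> P \<in> Obj C \<and> Y \<in> I \<rightarrow> Obj C \<and>
     (\<exists>inj proj. (\<forall>i \<in> I. inj i \<in> Hom C (Y i) P \<and> proj i \<in> Hom C P (Y i))
        \<and> (\<forall>i \<in> I. proj i \<cdot>\<^bsub>C\<^esub> inj i = \<iota>\<^bsub>C\<^esub> (Y i))
        \<and> (\<forall>i \<in> I. \<forall>j \<in> I. i \<noteq> j \<longrightarrow> proj j \<cdot>\<^bsub>C\<^esub> inj i = \<zero>\<^bsub>H (Y i) (Y j)\<^esub>)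
        \<and> (\<Oplus>\<^bsub>H P P\<^esub> i \<in> I. inj i \<cdot>\<^bsub>C\<^esub> proj i) = \<iota>\<^bsub>C\<^esub> P)"

definition is_mono :: "('o, 'm, 'z) category_scheme \<Rightarrow> 'm \<Rightarrow> bool" where
  "is_mono C f \<longleftrightarrow> f \<in> Arr C \<and>
     (\<forall>W \<in> Obj C. \<forall>u \<in> Hom C W (Dom C f). \<forall>v \<in> Hom C W (Dom C f). f \<cdot>\<^bsub>C\<^esub> u = f \<cdot>\<^bsub>C\<^esub> v \<longrightarrow> u = v)"

definition is_epi :: "('o, 'm, 'z) category_scheme \<Rightarrow> 'm \<Rightarrow> bool" where
  "is_epi C f \<longleftrightarrow> f \<in> Arr C \<and>
     (\<forall>W \<in> Obj C. \<forall>u \<in> Hom C (Cod C f) W. \<forall>v \<in> Hom C (Cod C f) W. u \<cdot>\<^bsub>C\<^esub> f = v \<cdot>\<^bsub>C\<^esub> f \<longrightarrow> u = v)"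

text \<open>\<open>is_kernel C H f i\<close>: \<open>i\<close> is a kernel of \<open>f\<close>; likewise \<open>is_cokernel C H f p\<close>.\<close>

definition is_kernel ::
  "('o, 'm, 'z) category_scheme \<Rightarrow> ('o \<Rightarrow> 'o \<Rightarrow> ('k, 'm) module) \<Rightarrow> 'm \<Rightarrow> 'm \<Rightarrow> bool" where
  "is_kernel C H f i \<longleftrightarrow> f \<in> Arr C \<and> i \<in> Arr C \<and> Cod C i = Dom C f
     \<and> f \<cdot>\<^bsub>C\<^esub> i = \<zero>\<^bsub>H (Dom C i) (Cod C f)\<^esub>
     \<and> (\<forall>W \<in> Obj C. \<forall>u \<in> Hom C W (Dom C f). f \<cdot>\<^bsub>C\<^esub> u = \<zero>\<^bsub>H W (Cod C f)\<^esub> \<longrightarrow>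
          (\<exists>!v. v \<in> Hom C W (Dom C i) \<and> i \<cdot>\<^bsub>C\<^esub> v = u))"

definition is_cokernel ::
  "('o, 'm, 'z) category_scheme \<Rightarrow> ('o \<Rightarrow> 'o \<Rightarrow> ('k, 'm) module) \<Rightarrow> 'm \<Rightarrow> 'm \<Rightarrow> bool" where
  "is_cokernel C H f p \<longleftrightarrow> f \<in> Arr C \<and> p \<in> Arr C \<and> Dom C p = Cod C f
     \<and> p \<cdot>\<^bsub>C\<^esub> f = \<zero>\<^bsub>H (Dom C f) (Cod C p)\<^esub>
     \<and> (\<forall>W \<in> Obj C. \<forall>u \<in> Hom C (Cod C f) W. u \<cdot>\<^bsub>C\<^esub> f = \<zero>\<^bsub>H (Dom C f) W\<^esub> \<longrightarrow>
          (\<exists>!v. v \<in> Hom C (Cod C p) W \<and> v \<cdot>\<^bsub>C\<^esub> p = u))"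

locale linear_abelian_category = linear_category +
  assumes ex_zero_object: "\<exists>Z. zero_object C Z"
    and ex_binary_direct_sum: "\<lbrakk>X \<in> Obj C; Y \<in> Obj C\<rbrakk>
          \<Longrightarrow> \<exists>P. direct_sum C H (UNIV :: bool set) (\<lambda>b. if b then X else Y) P"
    and ex_kernel: "f \<in> Arr C \<Longrightarrow> \<exists>i. is_kernel C H f i"
    and ex_cokernel: "f \<in> Arr C \<Longrightarrow> \<exists>p. is_cokernel C H f p"
    and mono_is_kernel: "is_mono C f \<Longrightarrow> \<exists>g. is_kernel C H g f"
    and epi_is_cokernel: "is_epi C f \<Longrightarrow> \<exists>g. is_cokernel C H g f"

definition linear_functor ::
  "('k, 'x) ring_scheme \<Rightarrow> ('o, 'm, 'y) category_scheme \<Rightarrow> ('o \<Rightarrow> 'o \<Rightarrow> ('k, 'm) module)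
    \<Rightarrow> ('p \<Rightarrow> 'p \<Rightarrow> ('k, 'n) module) \<Rightarrow> ('o, 'm, 'p, 'n, 'w) Functor_scheme \<Rightarrow> bool" where
  "linear_functor k C H H' F \<longleftrightarrow>
     (\<forall>X \<in> Obj C. \<forall>Y \<in> Obj C. \<forall>f \<in> Hom C X Y.
        (\<forall>g \<in> Hom C X Y. FArr F (f \<oplus>\<^bsub>H X Y\<^esub> g) = FArr F f \<oplus>\<^bsub>H' (FObj F X) (FObj F Y)\<^esub> FArr F g)
        \<and> (\<forall>a \<in> carrier k. FArr F (a \<odot>\<^bsub>H X Y\<^esub> f) = a \<odot>\<^bsub>H' (FObj F X) (FObj F Y)\<^esub> FArr F f))"

definition bilinear_tensor ::
  "('k, 'x) ring_scheme \<Rightarrow> ('o, 'm, 'y) monoidal_category_scheme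
    \<Rightarrow> ('o \<Rightarrow> 'o \<Rightarrow> ('k, 'm) module) \<Rightarrow> bool" where
  "bilinear_tensor k C H \<longleftrightarrow>
     (\<forall>X \<in> Obj C. \<forall>X' \<in> Obj C. \<forall>Y \<in> Obj C. \<forall>Y' \<in> Obj C. \<forall>f \<in> Hom C X X'. \<forall>g \<in> Hom C Y Y'.
        (\<forall>f' \<in> Hom C X X'. (f \<oplus>\<^bsub>H X X'\<^esub> f') \<otimes>\<^sub>a\<^bsub>C\<^esub> g
           = (f \<otimes>\<^sub>a\<^bsub>C\<^esub> g) \<oplus>\<^bsub>H (X \<otimes>\<^sub>o\<^bsub>C\<^esub> Y) (X' \<otimes>\<^sub>o\<^bsub>C\<^esub> Y')\<^esub> (f' \<otimes>\<^sub>a\<^bsub>C\<^esub> g))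
        \<and> (\<forall>g' \<in> Hom C Y Y'. f \<otimes>\<^sub>a\<^bsub>C\<^esub> (g \<oplus>\<^bsub>H Y Y'\<^esub> g')
           = (f \<otimes>\<^sub>a\<^bsub>C\<^esub> g) \<oplus>\<^bsub>H (X \<otimes>\<^sub>o\<^bsub>C\<^esub> Y) (X' \<otimes>\<^sub>o\<^bsub>C\<^esub> Y')\<^esub> (f \<otimes>\<^sub>a\<^bsub>C\<^esub> g'))
        \<and> (\<forall>a \<in> carrier k.
             (a \<odot>\<^bsub>H X X'\<^esub> f) \<otimes>\<^sub>a\<^bsub>C\<^esub> g = a \<odot>\<^bsub>H (X \<otimes>\<^sub>o\<^bsub>C\<^esub> Y) (X' \<otimes>\<^sub>o\<^bsub>C\<^esub> Y')\<^esub> (f \<otimes>\<^sub>a\<^bsub>C\<^esub> g)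
             \<and> f \<otimes>\<^sub>a\<^bsub>C\<^esub> (a \<odot>\<^bsub>H Y Y'\<^esub> g) = a \<odot>\<^bsub>H (X \<otimes>\<^sub>o\<^bsub>C\<^esub> Y) (X' \<otimes>\<^sub>o\<^bsub>C\<^esub> Y')\<^esub> (f \<otimes>\<^sub>a\<^bsub>C\<^esub> g)))"

definition linear_action ::
  "('g, 'w) monoid_scheme \<Rightarrow> ('k, 'x) ring_scheme \<Rightarrow> ('g, 'o, 'm, 'y) crossed_category_scheme
    \<Rightarrow> ('o \<Rightarrow> 'o \<Rightarrow> ('k, 'm) module) \<Rightarrow> bool" where
  "linear_action G k C H \<longleftrightarrow> (\<forall>g \<in> carrier G. linear_functor k C H H (act C g))"


section \<open>Braided G-crossed categories\<close>

text \<open>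
  The decomposition \<open>C = \<Coprod>\<^sub>g C\<^sub>g\<close>.  As a coproduct of categories it is a disjoint union, in which no
  arrow joins different components; each \<open>C\<^sub>g\<close> is then full and is determined by its objects.
  As a coproduct of \<open>k\<close>-linear abelian categories it consists of mutually orthogonal full
  subcategories \<open>C\<^sub>g\<close>, themselves \<open>k\<close>-linear abelian, such that every object is a finite direct sum of
  objects of the \<open>C\<^sub>g\<close>.
\<close>

definition coproduct_decomposition ::
  "('g, 'x) monoid_scheme \<Rightarrow> ('g, 'o, 'm, 'z) crossed_category_scheme \<Rightarrow> bool" where
  "coproduct_decomposition G C \<longleftrightarrow>
     (\<Union>g \<in> carrier G. deg C g) = Obj C
     \<and> (\<forall>g \<in> carrier G. \<forall>h \<in> carrier G. g \<noteq> h \<longrightarrow> deg C g \<inter> deg C h = {})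
     \<and> (\<forall>f \<in> Arr C. \<exists>g \<in> carrier G. Dom C f \<in> deg C g \<and> Cod C f \<in> deg C g)"

definition linear_coproduct_decomposition ::
  "('g, 'x) monoid_scheme \<Rightarrow> ('k, 'y) ring_scheme \<Rightarrow> ('g, 'o, 'm, 'z) crossed_category_scheme
    \<Rightarrow> ('o \<Rightarrow> 'o \<Rightarrow> ('k, 'm) module) \<Rightarrow> bool" where
  "linear_coproduct_decomposition G k C H \<longleftrightarrow>
     (\<forall>g \<in> carrier G. deg C g \<subseteq> Obj C \<and> linear_abelian_category k (full_subcat C (deg C g)) H)
     \<and> (\<forall>g \<in> carrier G. \<forall>h \<in> carrier G. g \<noteq> h \<longrightarrow>
          (\<forall>X \<in> deg C g. \<forall>Y \<in> deg C h. Hom C X Y = {\<zero>\<^bsub>H X Y\<^esub>}))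
     \<and> (\<forall>X \<in> Obj C. \<exists>S Y. S \<subseteq> carrier G \<and> (\<forall>g \<in> S. Y g \<in> deg C g) \<and> direct_sum C H S Y X)"

locale graded_braiding = monoidal_G_category +
  assumes deg_Obj: "g \<in> carrier G \<Longrightarrow> deg C g \<subseteq> Obj C"
    and deg_unit: "\<I> \<in> deg C \<one>\<^bsub>G\<^esub>"
    and deg_tensor: "\<lbrakk>g \<in> carrier G; h \<in> carrier G; X \<in> deg C g; Y \<in> deg C h\<rbrakk>
          \<Longrightarrow> X \<otimes>\<^sub>o Y \<in> deg C (g \<otimes>\<^bsub>G\<^esub> h)"
    and deg_act: "\<lbrakk>g \<in> carrier G; h \<in> carrier G; X \<in> deg C h\<rbrakk>
          \<Longrightarrow> act_obj C g X \<in> deg C (g \<otimes>\<^bsub>G\<^esub> h \<otimes>\<^bsub>G\<^esub> inv\<^bsub>G\<^esub> g)"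
    and braid_iso: "\<lbrakk>g \<in> carrier G; X \<in> deg C g; Y \<in> Obj C\<rbrakk>
          \<Longrightarrow> braid C g X Y \<in> Hom C (X \<otimes>\<^sub>o Y) (act_obj C g Y \<otimes>\<^sub>o X) \<and> is_iso C (braid C g X Y)"
    and braid_natural: "\<lbrakk>g \<in> carrier G; X \<in> deg C g; X' \<in> deg C g; f \<in> Hom C X X'; f' \<in> Hom C Y Y'\<rbrakk>
          \<Longrightarrow> braid C g X' Y' \<cdot> (f \<otimes>\<^sub>a f') = (act_arr C g f' \<otimes>\<^sub>a f) \<cdot> braid C g X Y"
    and braid_act: "\<lbrakk>g \<in> carrier G; h \<in> carrier G; X \<in> deg C h; Z \<in> Obj C\<rbrakk>
          \<Longrightarrow> psi C g (act_obj C h Z) X \<cdot> act_arr C g (braid C h X Z)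
            = (phi C g h Z \<otimes>\<^sub>a \<iota> (act_obj C g X))
              \<cdot> (inv_arrow C (phi C (g \<otimes>\<^bsub>G\<^esub> h \<otimes>\<^bsub>G\<^esub> inv\<^bsub>G\<^esub> g) g Z) \<otimes>\<^sub>a \<iota> (act_obj C g X))
              \<cdot> braid C (g \<otimes>\<^bsub>G\<^esub> h \<otimes>\<^bsub>G\<^esub> inv\<^bsub>G\<^esub> g) (act_obj C g X) (act_obj C g Z)
              \<cdot> psi C g X Z"
    and braid_tensor_right: "\<lbrakk>g \<in> carrier G; X \<in> deg C g; Y \<in> Obj C; Z \<in> Obj C\<rbrakk>
          \<Longrightarrow> (psi C g Y Z \<otimes>\<^sub>a \<iota> X) \<cdot> braid C g X (Y \<otimes>\<^sub>o Z)
            = (\<iota> (act_obj C g Y) \<otimes>\<^sub>a braid C g X Z) \<cdot> (braid C g X Y \<otimes>\<^sub>a \<iota> Z)"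
    and braid_tensor_left: "\<lbrakk>g \<in> carrier G; h \<in> carrier G; X \<in> deg C g; Y \<in> deg C h; Z \<in> Obj C\<rbrakk>
          \<Longrightarrow> (phi C g h Z \<otimes>\<^sub>a \<iota> (X \<otimes>\<^sub>o Y)) \<cdot> braid C (g \<otimes>\<^bsub>G\<^esub> h) (X \<otimes>\<^sub>o Y) Z
            = (braid C g X (act_obj C h Z) \<otimes>\<^sub>a \<iota> Y) \<cdot> (\<iota> X \<otimes>\<^sub>a braid C h Y Z)"

locale braided_G_crossed_category = graded_braiding +
  assumes coproduct: "coproduct_decomposition G C"

text \<open>
  The linear variant: \<open>C\<close> is \<open>k\<close>-linear abelian and the coproduct is the \<open>k\<close>-linear abelian one.
  Bilinearity of the tensor product and linearity of the functors \<open>g\<^sub>*\<close> are kept as the separate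
  predicates \<^const>\<open>bilinear_tensor\<close> and \<^const>\<open>linear_action\<close>.
\<close>

locale linear_braided_G_crossed_category =
  graded_braiding G C + linear_abelian_category k C H
  for G and k and C (structure) and H +
  assumes coproduct: "linear_coproduct_decomposition G k C H"

definition braided_G_crossed_functor ::
  "('g, 'x) monoid_scheme \<Rightarrow> ('g, 'o, 'm, 'y) crossed_category_scheme
    \<Rightarrow> ('g, 'p, 'n, 'z) crossed_category_scheme
    \<Rightarrow> ('o, 'm, 'p, 'n) mon_Functor \<Rightarrow> ('g \<Rightarrow> 'o \<Rightarrow> 'n) \<Rightarrow> bool" where
  "braided_G_crossed_functor G C D F \<eta> \<longleftrightarrow>
     monoidal_G_functor G C D F \<eta>
     \<and> (\<forall>g \<in> carrier G. FObj F ` deg C g \<subseteq> deg D g)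
     \<and> (\<forall>g \<in> carrier G. \<forall>X \<in> deg C g. \<forall>Y \<in> Obj C.
          F2 F (act_obj C g Y) X \<cdot>\<^bsub>D\<^esub> FArr F (braid C g X Y)
          = (\<eta> g Y \<otimes>\<^sub>a\<^bsub>D\<^esub> \<iota>\<^bsub>D\<^esub> (FObj F X)) \<cdot>\<^bsub>D\<^esub> braid D g (FObj F X) (FObj F Y) \<cdot>\<^bsub>D\<^esub> F2 F X Y)"

definition braided_G_crossed_equivalence ::
  "('g, 'x) monoid_scheme \<Rightarrow> ('g, 'o, 'm, 'y) crossed_category_scheme
    \<Rightarrow> ('g, 'p, 'n, 'z) crossed_category_scheme
    \<Rightarrow> ('o, 'm, 'p, 'n) mon_Functor \<Rightarrow> ('g \<Rightarrow> 'o \<Rightarrow> 'n) \<Rightarrow> bool" where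
  "braided_G_crossed_equivalence G C D F \<eta> \<longleftrightarrow>
     braided_G_crossed_functor G C D F \<eta> \<and> is_equivalence C D F"

text \<open>
  HOL cannot quantify existentially over types, so the strict category has to be sought over types
  given in advance.  Those below are large enough for \<open>G\<close>-equivariant families in \<open>C\<close>: objects
  \<open>X\<^sub>g\<close> with structure arrows \<open>g\<^sub>*(X\<^sub>h) \<rightarrow> X\<^sub>g\<^sub>h\<close>, and families of arrows tagged with domain and codomain.
\<close>

type_synonym ('g, 'o, 'm) family_obj = "('g \<Rightarrow> 'o) \<times> ('g \<Rightarrow> 'g \<Rightarrow> 'm)"

type_synonym ('g, 'o, 'm) family_arr =
  "('g, 'o, 'm) family_obj \<times> ('g, 'o, 'm) family_obj \<times> ('g \<Rightarrow> 'm)"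

type_synonym ('g, 'o, 'm) family_category =
  "('g, ('g, 'o, 'm) family_obj, ('g, 'o, 'm) family_arr) crossed_category"

end

theory Submission
  imports Defs
begin

text \<open>
  The proof replaces an object of \<open>C\<close> by a family \<open>(X\<^sub>k)\<close> indexed by the group, together with coherent
  isomorphisms \<open>\<gamma>(g,h) : g\<^sub>*(X\<^sub>h) \<rightarrow> X\<^sub>g\<^sub>h\<close>.  Such a family behaves like the orbit of \<open>X\<^sub>1\<close>, but its
  members are chosen freely within their isomorphism classes.  The group acts by shifting the index,
  \<open>(g\<^sub>*X)\<^sub>k = X\<^sub>k\<^sub>g\<close>, and the tensor product is formed in each index separately.  Composing two shifts is
  again a shift, and shifts commute with componentwise tensor products, so this action is strict although
  the one on \<open>C\<close> is not: the constraints \<open>\<phi>\<close> and \<open>\<psi>\<close> have moved into the arrows \<open>\<gamma>\<close>.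

  A family is determined by \<open>X\<^sub>1\<close> up to a unique isomorphism that is the identity on \<open>X\<^sub>1\<close>.
  Arrows \<open>X \<rightarrow> Y\<close> are therefore taken to be arrows \<open>X\<^sub>1 \<rightarrow> Y\<^sub>1\<close> of \<open>C\<close>, so that evaluation at
  the neutral element is fully faithful by definition, and
  surjective on objects because each object has an orbit.  Categorical structure pulls back along such a
  functor, in particular linear abelian structure (\<open>linear_abelian_category_D\<close>), and the orbit functor is an
  equivalence in the other direction (\<open>is_equivalence_section\<close>).

  What remains to be constructed by hand are the action on arrows and the braiding.  An arrow \<open>f\<close> is shifted by
  \<open>g\<close> by conjugating \<open>g\<^sub>*(f)\<close> with the structure arrows; strictness of this action is the cocycle condition
  for \<open>\<gamma>\<close> (\<open>translate_mult\<close>).  The braiding of \<open>X\<close>, of degree \<open>g\<close>, with \<open>Y\<close> is the braiding of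
  \<open>X\<^sub>1\<close> with \<open>Y\<^sub>1\<close>, followed by \<open>\<gamma>(g,1) : g\<^sub>*(Y\<^sub>1) \<rightarrow> Y\<^sub>g\<close>.  Its invariance under the action
  (\<open>translate_braid_fam\<close>) uses the equivariance axiom of the braiding of \<open>C\<close>.
\<close>

section \<open>Arrows and isomorphisms\<close>

lemma full_subcat_simps [simp]:
  "Obj (full_subcat C S) = Obj C \<inter> S"
  "Arr (full_subcat C S) = {f \<in> Arr C. Dom C f \<in> S \<and> Cod C f \<in> S}"
  "Dom (full_subcat C S) = Dom C" "Cod (full_subcat C S) = Cod C"
  "ident (full_subcat C S) = ident C" "Comp (full_subcat C S) = Comp C"
  by (simp_all add: full_subcat_def)

context category
begin

lemma Hom_iff: "f \<in> Hom C X Y \<longleftrightarrow> f \<in> Arr C \<and> Dom C f = X \<and> Cod C f = Y"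
  by (simp add: Hom_def)

text \<open>
  The axioms are stated for hom sets and therefore contain objects that occur in the premises only.
  Restated through \<open>Dom\<close> and \<open>Cod\<close> they are conditional rewrite rules whose side conditions the
  simplifier computes from the arrows themselves.
\<close>

lemma ident_simps [simp]:
  assumes "X \<in> Obj C"
  shows "\<iota> X \<in> Arr C" "Dom C (\<iota> X) = X" "Cod C (\<iota> X) = X"
  using ident_in_Hom[OF assms] by (simp_all add: Hom_iff)

lemma Comp_simps [simp]:
  assumes "f \<in> Arr C" "g \<in> Arr C" "Dom C g = Cod C f"
  shows "g \<cdot> f \<in> Arr C" "Dom C (g \<cdot> f) = Dom C f" "Cod C (g \<cdot> f) = Cod C g"
  using Comp_in_Hom[of f "Dom C f" "Cod C f" g "Cod C g"] assms by (simp_all add: Hom_iff)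

lemma arr_Obj [simp]:
  assumes "f \<in> Arr C" shows "Dom C f \<in> Obj C" "Cod C f \<in> Obj C"
  using assms Dom_in_Obj Cod_in_Obj by auto

lemma Comp_ident [simp]:
  "f \<in> Arr C \<Longrightarrow> Dom C f = X \<Longrightarrow> f \<cdot> \<iota> X = f"
  "f \<in> Arr C \<Longrightarrow> Cod C f = X \<Longrightarrow> \<iota> X \<cdot> f = f"
  using Comp_ident_right Comp_ident_left by (auto simp: Hom_iff)

lemma assoc [simp]:
  "\<lbrakk>f \<in> Arr C; g \<in> Arr C; h \<in> Arr C; Dom C g = Cod C f; Dom C h = Cod C g\<rbrakk>
    \<Longrightarrow> (h \<cdot> g) \<cdot> f = h \<cdot> (g \<cdot> f)"
  using Comp_assoc by (auto simp: Hom_iff)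

lemma inverse_arrows_unique:
  assumes "inverse_arrows C f g" "inverse_arrows C f g'"
  shows "g = g'"
proof -
  have "(g \<cdot> f) \<cdot> g' = g \<cdot> (f \<cdot> g')"
    using assms by (intro assoc) (simp_all add: inverse_arrows_def Hom_iff)
  then show ?thesis using assms by (simp add: inverse_arrows_def Hom_iff)
qed

lemma inv_arrow_eq: "inverse_arrows C f g \<Longrightarrow> inv_arrow C f = g"
  unfolding inv_arrow_def using inverse_arrows_unique by blast

lemma inverse_arrows_inv: "is_iso C f \<Longrightarrow> inverse_arrows C f (inv_arrow C f)"
  using inv_arrow_eq by (auto simp: is_iso_def)

lemma iso_Arr: "is_iso C f \<Longrightarrow> f \<in> Arr C"
  by (auto simp: is_iso_def inverse_arrows_def)

lemma inv_arrow_simps [simp]: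
  assumes "is_iso C f"
  shows "inv_arrow C f \<in> Arr C" "Dom C (inv_arrow C f) = Cod C f" "Cod C (inv_arrow C f) = Dom C f"
    "inv_arrow C f \<cdot> f = \<iota> (Dom C f)" "f \<cdot> inv_arrow C f = \<iota> (Cod C f)"
  using inverse_arrows_inv[OF assms] by (auto simp: inverse_arrows_def Hom_iff)

lemma inv_arrow_cancel [simp]:
  assumes "is_iso C f" "g \<in> Arr C"
  shows "Cod C g = Dom C f \<Longrightarrow> inv_arrow C f \<cdot> (f \<cdot> g) = g"
    "Cod C g = Cod C f \<Longrightarrow> f \<cdot> (inv_arrow C f \<cdot> g) = g"
proof -
  note iso_Arr[OF assms(1), simp]
  show "Cod C g = Dom C f \<Longrightarrow> inv_arrow C f \<cdot> (f \<cdot> g) = g"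
    using assms by (subst assoc[symmetric]) simp_all
  show "Cod C g = Cod C f \<Longrightarrow> f \<cdot> (inv_arrow C f \<cdot> g) = g"
    using assms by (subst assoc[symmetric]) simp_all
qed

lemma is_isoI:
  "\<lbrakk>f \<in> Arr C; g \<in> Arr C; Dom C g = Cod C f; Cod C g = Dom C f;
    g \<cdot> f = \<iota> (Dom C f); f \<cdot> g = \<iota> (Cod C f)\<rbrakk> \<Longrightarrow> is_iso C f"
  by (auto simp: is_iso_def inverse_arrows_def Hom_iff)

lemma iso_ident [simp]: "X \<in> Obj C \<Longrightarrow> is_iso C (\<iota> X)"
  by (rule is_isoI[of _ "\<iota> X"]) simp_all

lemma inv_ident [simp]: "X \<in> Obj C \<Longrightarrow> inv_arrow C (\<iota> X) = \<iota> X"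
  by (rule inv_arrow_eq) (simp add: inverse_arrows_def Hom_iff)

lemma iso_inv [simp]: "is_iso C f \<Longrightarrow> is_iso C (inv_arrow C f)"
  by (rule is_isoI[of _ f]) (simp_all add: iso_Arr)

lemma iso_Comp [simp]:
  assumes "is_iso C f" "is_iso C g" "Dom C g = Cod C f"
  shows "is_iso C (g \<cdot> f)"
  using assms iso_Arr by (intro is_isoI[of _ "inv_arrow C f \<cdot> inv_arrow C g"]) simp_all

lemma iso_cancel_right:
  assumes "is_iso C h" "f \<in> Arr C" "g \<in> Arr C" "Dom C f = Cod C h" "Dom C g = Cod C h"
    and "f \<cdot> h = g \<cdot> h"
  shows "f = g"
proof -
  have "(f \<cdot> h) \<cdot> inv_arrow C h = (g \<cdot> h) \<cdot> inv_arrow C h"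
    using assms(6) by simp
  then show ?thesis using assms(1-5) by (simp add: iso_Arr)
qed

text \<open>
  Unit constraints that are not among the axioms, such as the one for the structure arrows of an
  equivariant family at the neutral element, are obtained by showing that they are idempotent.
\<close>

lemma idempotent_iso:
  assumes "is_iso C f" "Dom C f = Cod C f" "f \<cdot> f = f"
  shows "f = \<iota> (Dom C f)"
  by (rule iso_cancel_right[OF assms(1)]) (use assms iso_Arr[OF assms(1)] in simp_all)

text \<open>
  Composites are kept associated to the right; this extends an equation between composites to one
  that can be applied in the middle of such a chain.
\<close>

lemma Comp_eq_assoc:
  "\<lbrakk>f \<cdot> g = r; f \<in> Arr C; g \<in> Arr C; Dom C f = Cod C g; k \<in> Arr C; Cod C k = Dom C g\<rbrakk>
    \<Longrightarrow> f \<cdot> (g \<cdot> k) = r \<cdot> k"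
  using assoc[of k g f] by simp

end

context monoidal_category
begin

lemmas tensor_obj_simps [simp] = unit_in_Obj tensor_obj_closed tensor_obj_assoc tensor_obj_unit

lemma tensor_arr_simps [simp]:
  assumes "f \<in> Arr C" "g \<in> Arr C"
  shows "f \<otimes>\<^sub>a g \<in> Arr C" "Dom C (f \<otimes>\<^sub>a g) = Dom C f \<otimes>\<^sub>o Dom C g"
    "Cod C (f \<otimes>\<^sub>a g) = Cod C f \<otimes>\<^sub>o Cod C g"
  using tensor_arr_in_Hom[of f "Dom C f" "Cod C f" g "Dom C g" "Cod C g"] assms
  by (simp_all add: Hom_iff)

lemmas tensor_arr_laws [simp] = tensor_arr_assoc tensor_arr_unit tensor_ident

text \<open>
  The interchange law is oriented so that a chain of tensor products of arrows collapses into a tensor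
  product of chains; the second form acts in front of a remaining arrow \<open>k\<close>.
\<close>

lemma interchange [simp]:
  assumes "f \<in> Arr C" "f' \<in> Arr C" "g \<in> Arr C" "g' \<in> Arr C" "Dom C f' = Cod C f" "Dom C g' = Cod C g"
  shows "(f' \<otimes>\<^sub>a g') \<cdot> (f \<otimes>\<^sub>a g) = (f' \<cdot> f) \<otimes>\<^sub>a (g' \<cdot> g)"
    and "k \<in> Arr C \<Longrightarrow> Cod C k = Dom C f \<otimes>\<^sub>o Dom C g \<Longrightarrow>
          (f' \<otimes>\<^sub>a g') \<cdot> ((f \<otimes>\<^sub>a g) \<cdot> k) = ((f' \<cdot> f) \<otimes>\<^sub>a (g' \<cdot> g)) \<cdot> k"
proof -
  show *: "(f' \<otimes>\<^sub>a g') \<cdot> (f \<otimes>\<^sub>a g) = (f' \<cdot> f) \<otimes>\<^sub>a (g' \<cdot> g)"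
    using assms tensor_Comp[of f "Dom C f" "Cod C f" f' "Cod C f'" g "Dom C g" "Cod C g" g' "Cod C g'"]
    by (simp add: Hom_iff)
  show "k \<in> Arr C \<Longrightarrow> Cod C k = Dom C f \<otimes>\<^sub>o Dom C g \<Longrightarrow>
          (f' \<otimes>\<^sub>a g') \<cdot> ((f \<otimes>\<^sub>a g) \<cdot> k) = ((f' \<cdot> f) \<otimes>\<^sub>a (g' \<cdot> g)) \<cdot> k"
    using assms by (subst Comp_eq_assoc[OF *]) simp_all
qed

lemma iso_tensor [simp]:
  assumes "is_iso C f" "is_iso C g" shows "is_iso C (f \<otimes>\<^sub>a g)"
  using assms iso_Arr by (intro is_isoI[of _ "inv_arrow C f \<otimes>\<^sub>a inv_arrow C g"]) simp_all

end

section \<open>Pulling back linear abelian structures\<close>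

lemma finsum_additive:
  assumes "abelian_monoid A" "abelian_monoid B" "finite I" "f \<in> I \<rightarrow> carrier A"
    and h: "h \<in> carrier A \<rightarrow> carrier B" "h \<zero>\<^bsub>A\<^esub> = \<zero>\<^bsub>B\<^esub>"
    and add: "\<And>x y. x \<in> carrier A \<Longrightarrow> y \<in> carrier A \<Longrightarrow> h (x \<oplus>\<^bsub>A\<^esub> y) = h x \<oplus>\<^bsub>B\<^esub> h y"
  shows "h (\<Oplus>\<^bsub>A\<^esub> i \<in> I. f i) = (\<Oplus>\<^bsub>B\<^esub> i \<in> I. h (f i))"
proof -
  interpret A: abelian_monoid A by fact
  interpret B: abelian_monoid B by fact
  from \<open>finite I\<close> \<open>f \<in> I \<rightarrow> carrier A\<close> show ?thesis
  proof (induction I)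
    case empty then show ?case by (simp add: h)
  next
    case (insert i I)
    then have "f i \<in> carrier A" "f \<in> I \<rightarrow> carrier A" "(\<lambda>i. h (f i)) \<in> I \<rightarrow> carrier B"
      using h(1) by auto
    moreover from this have "h (f i) \<in> carrier B" using h(1) by blast
    ultimately show ?case using insert by (simp add: add)
  qed
qed

lemma direct_sum_cong:
  "(\<And>i. i \<in> I \<Longrightarrow> Y i = Y' i) \<Longrightarrow> direct_sum C H I Y P \<longleftrightarrow> direct_sum C H I Y' P"
  unfolding direct_sum_def Pi_iff by (simp cong: ball_cong)

text \<open>
  The module structure on the arrows of a category \<open>D\<close> that corresponds to the one of \<open>H\<close> under a
  bijection of hom sets: \<open>p\<close> and \<open>q\<close> are the object and arrow parts of a functor out of \<open>D\<close>, and
  \<open>lift X Y\<close> is the inverse of \<open>q\<close> on the arrows from \<open>X\<close> to \<open>Y\<close>.  The carrier is written as an image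
  so that the module does not mention \<open>D\<close>; the same family of modules then serves \<open>D\<close> and its full
  subcategories.
\<close>

definition pull_module ::
  "('p \<Rightarrow> 'o) \<Rightarrow> ('n \<Rightarrow> 'm) \<Rightarrow> ('p \<Rightarrow> 'p \<Rightarrow> 'm \<Rightarrow> 'n) \<Rightarrow> ('o \<Rightarrow> 'o \<Rightarrow> ('k, 'm) module)
    \<Rightarrow> 'p \<Rightarrow> 'p \<Rightarrow> ('k, 'n) module" where
  "pull_module p q lift H X Y =
     \<lparr>carrier = lift X Y ` carrier (H (p X) (p Y)),
      mult = undefined, one = undefined,
      zero = lift X Y \<zero>\<^bsub>H (p X) (p Y)\<^esub>,
      add = (\<lambda>f g. lift X Y (q f \<oplus>\<^bsub>H (p X) (p Y)\<^esub> q g)),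
      smult = (\<lambda>a f. lift X Y (a \<odot>\<^bsub>H (p X) (p Y)\<^esub> q f))\<rparr>"

lemma pull_module_simps:
  "carrier (pull_module p q lift H X Y) = lift X Y ` carrier (H (p X) (p Y))"
  "\<zero>\<^bsub>pull_module p q lift H X Y\<^esub> = lift X Y \<zero>\<^bsub>H (p X) (p Y)\<^esub>"
  "f \<oplus>\<^bsub>pull_module p q lift H X Y\<^esub> g = lift X Y (q f \<oplus>\<^bsub>H (p X) (p Y)\<^esub> q g)"
  "a \<odot>\<^bsub>pull_module p q lift H X Y\<^esub> f = lift X Y (a \<odot>\<^bsub>H (p X) (p Y)\<^esub> q f)"
  by (simp_all add: pull_module_def)

lemma module_pull_module:
  assumes "module k (H (p X) (p Y))"
    and q: "\<And>f. f \<in> carrier (H (p X) (p Y)) \<Longrightarrow> q (lift X Y f) = f"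
  shows "module k (pull_module p q lift H X Y)"
proof -
  let ?H = "H (p X) (p Y)"
  interpret module k ?H by fact
  show ?thesis
  proof (rule moduleI)
    show "abelian_group (pull_module p q lift H X Y)"
    proof (rule abelian_groupI)
      fix f assume "f \<in> carrier (pull_module p q lift H X Y)"
      then obtain f' where f': "f' \<in> carrier ?H" "f = lift X Y f'"
        by (auto simp: pull_module_simps)
      then show "\<exists>g\<in>carrier (pull_module p q lift H X Y).
          g \<oplus>\<^bsub>pull_module p q lift H X Y\<^esub> f = \<zero>\<^bsub>pull_module p q lift H X Y\<^esub>"
        by (intro bexI[of _ "lift X Y (\<ominus>\<^bsub>?H\<^esub> f')"]) (auto simp: pull_module_simps q M.l_neg)
    qed (auto simp: pull_module_simps q M.a_assoc M.a_comm M.a_lcomm)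
  qed (auto simp: pull_module_simps q R.is_cring smult_l_distr smult_r_distr smult_assoc1
        intro: R.is_cring)
qed

text \<open>
  A fully faithful functor \<open>(p, q)\<close> that is surjective on objects.  Identities and composites of \<open>D\<close>
  are the lifts of those of \<open>C\<close>, from which the category axioms for \<open>D\<close> are derived.
\<close>

locale fully_faithful_cover = category C
  for C :: "('o, 'm, 'z) category_scheme" (structure) +
  fixes D :: "('p, 'n, 'y) category_scheme" and p q lift
  assumes arr_Obj_D: "f \<in> Arr D \<Longrightarrow> Dom D f \<in> Obj D \<and> Cod D f \<in> Obj D"
    and image_Obj: "p ` Obj D = Obj C"
    and lift_Hom: "\<lbrakk>X \<in> Obj D; Y \<in> Obj D; u \<in> Hom C (p X) (p Y)\<rbrakk> \<Longrightarrow> lift X Y u \<in> Hom D X Y"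
    and q_lift: "\<lbrakk>X \<in> Obj D; Y \<in> Obj D; u \<in> Hom C (p X) (p Y)\<rbrakk> \<Longrightarrow> q (lift X Y u) = u"
    and q_Hom: "f \<in> Hom D X Y \<Longrightarrow> q f \<in> Hom C (p X) (p Y)"
    and lift_q: "f \<in> Hom D X Y \<Longrightarrow> lift X Y (q f) = f"
    and ident_lift: "X \<in> Obj D \<Longrightarrow> ident D X = lift X X (\<iota> (p X))"
    and Comp_lift: "\<lbrakk>f \<in> Hom D X Y; g \<in> Hom D Y Z\<rbrakk> \<Longrightarrow> g \<cdot>\<^bsub>D\<^esub> f = lift X Z (q g \<cdot> q f)"
begin

lemma p_Obj [simp]: "X \<in> Obj D \<Longrightarrow> p X \<in> Obj C"
  using image_Obj by blast

lemma q_Arr [simp]: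
  assumes "f \<in> Arr D"
  shows "q f \<in> Arr C" "Dom C (q f) = p (Dom D f)" "Cod C (q f) = p (Cod D f)"
  using q_Hom[of f "Dom D f" "Cod D f"] assms by (auto simp: Hom_def)

lemma lift_Arr [simp]:
  assumes "X \<in> Obj D" "Y \<in> Obj D" "u \<in> Arr C" "Dom C u = p X" "Cod C u = p Y"
  shows "lift X Y u \<in> Arr D" "Dom D (lift X Y u) = X" "Cod D (lift X Y u) = Y" "q (lift X Y u) = u"
  using lift_Hom[of X Y u] q_lift[of X Y u] assms by (auto simp: Hom_def)

lemma q_inject:
  "\<lbrakk>q f = q g; f \<in> Arr D; g \<in> Arr D; Dom D f = Dom D g; Cod D f = Cod D g\<rbrakk> \<Longrightarrow> f = g"
  by (metis (mono_tags, lifting) Hom_def lift_q mem_Collect_eq)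

lemma Comp_Arr_D [simp]:
  assumes "f \<in> Arr D" "g \<in> Arr D" "Dom D g = Cod D f"
  shows "g \<cdot>\<^bsub>D\<^esub> f \<in> Arr D" "Dom D (g \<cdot>\<^bsub>D\<^esub> f) = Dom D f" "Cod D (g \<cdot>\<^bsub>D\<^esub> f) = Cod D g"
    "q (g \<cdot>\<^bsub>D\<^esub> f) = q g \<cdot> q f"
  using Comp_lift[of f "Dom D f" "Cod D f" g "Cod D g"] assms arr_Obj_D[of f] arr_Obj_D[of g]
  by (simp_all add: Hom_def)

lemma ident_D [simp]:
  assumes "X \<in> Obj D"
  shows "ident D X \<in> Arr D" "Dom D (ident D X) = X" "Cod D (ident D X) = X"
    "q (ident D X) = \<iota> (p X)"
  using ident_lift[OF assms] assms by simp_all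

lemma category_D: "category D"
  by standard (auto intro!: q_inject simp: Hom_def arr_Obj_D)

interpretation D: category D by (rule category_D)

lemma is_iso_D:
  assumes "f \<in> Arr D" "is_iso C (q f)"
  shows "is_iso D f"
  using assms
  by (intro D.is_isoI[where g = "lift (Cod D f) (Dom D f) (inv_arrow C (q f))"] q_inject) simp_all

text \<open>
  A strict section of the cover is an equivalence with the cover as quasi-inverse: one composite is the
  identity, and on the other side the identity of \<open>p X\<close> lifts to an isomorphism onto \<open>X\<close>.
\<close>

lemma is_equivalence_section:
  assumes F: "is_functor C D F"
    and s: "\<And>X. X \<in> Obj C \<Longrightarrow> p (FObj F X) = X" "\<And>f. f \<in> Arr C \<Longrightarrow> q (FArr F f) = f"
  shows "is_equivalence C D F"
proof -
  define K :: "('p, 'n, 'o, 'm) Functor" where "K = \<lparr>FObj = p, FArr = q\<rparr>"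
  have F' [simp]: "X \<in> Obj C \<Longrightarrow> FObj F X \<in> Obj D" "f \<in> Arr C \<Longrightarrow> FArr F f \<in> Arr D"
    "f \<in> Arr C \<Longrightarrow> Dom D (FArr F f) = FObj F (Dom C f)"
    "f \<in> Arr C \<Longrightarrow> Cod D (FArr F f) = FObj F (Cod C f)" for X f
    using F by (auto simp: is_functor_def Hom_def)
  have "is_functor D C K"
    by (auto simp: is_functor_def K_def Hom_def)
  moreover have "natural_iso C C (comp_functor K F) id_functor (\<lambda>X. \<iota> X)"
    by (auto simp: natural_iso_def comp_functor_def id_functor_def K_def Hom_def s)
  moreover have "natural_iso D D (comp_functor F K) id_functor (\<lambda>X. lift (FObj F (p X)) X (\<iota> (p X)))"
    by (auto simp: natural_iso_def comp_functor_def id_functor_def K_def Hom_def s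
        intro!: is_iso_D q_inject)
  ultimately show ?thesis using F by (auto simp: is_equivalence_def)
qed

end

context linear_category
begin

lemma H_Hom:
  assumes "X \<in> Obj C" "Y \<in> Obj C"
  shows "\<zero>\<^bsub>H X Y\<^esub> \<in> Hom C X Y"
    and "f \<in> Hom C X Y \<Longrightarrow> g \<in> Hom C X Y \<Longrightarrow> f \<oplus>\<^bsub>H X Y\<^esub> g \<in> Hom C X Y"
    and "a \<in> carrier k \<Longrightarrow> f \<in> Hom C X Y \<Longrightarrow> a \<odot>\<^bsub>H X Y\<^esub> f \<in> Hom C X Y"
proof -
  interpret M: module k "H X Y" by (rule Hom_module[OF assms])
  show "\<zero>\<^bsub>H X Y\<^esub> \<in> Hom C X Y"
    "f \<in> Hom C X Y \<Longrightarrow> g \<in> Hom C X Y \<Longrightarrow> f \<oplus>\<^bsub>H X Y\<^esub> g \<in> Hom C X Y"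
    "a \<in> carrier k \<Longrightarrow> f \<in> Hom C X Y \<Longrightarrow> a \<odot>\<^bsub>H X Y\<^esub> f \<in> Hom C X Y"
    using M.zero_closed M.a_closed[of f g] M.smult_closed[of a f] by (simp_all add: carrier_Hom assms)
qed

lemma H_Arr [simp]:
  assumes "X \<in> Obj C" "Y \<in> Obj C"
  shows "\<zero>\<^bsub>H X Y\<^esub> \<in> Arr C" "Dom C \<zero>\<^bsub>H X Y\<^esub> = X" "Cod C \<zero>\<^bsub>H X Y\<^esub> = Y"
    and "\<lbrakk>f \<in> Arr C; Dom C f = X; Cod C f = Y; g \<in> Arr C; Dom C g = X; Cod C g = Y\<rbrakk> \<Longrightarrow>
      f \<oplus>\<^bsub>H X Y\<^esub> g \<in> Arr C \<and> Dom C (f \<oplus>\<^bsub>H X Y\<^esub> g) = X \<and> Cod C (f \<oplus>\<^bsub>H X Y\<^esub> g) = Y"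
    and "\<lbrakk>a \<in> carrier k; f \<in> Arr C; Dom C f = X; Cod C f = Y\<rbrakk> \<Longrightarrow>
      a \<odot>\<^bsub>H X Y\<^esub> f \<in> Arr C \<and> Dom C (a \<odot>\<^bsub>H X Y\<^esub> f) = X \<and> Cod C (a \<odot>\<^bsub>H X Y\<^esub> f) = Y"
  using H_Hom[OF assms] by (simp_all add: Hom_iff)

end

context fully_faithful_cover
begin

interpretation D: category D by (rule category_D)

abbreviation HD :: "('o \<Rightarrow> 'o \<Rightarrow> ('k, 'm) module) \<Rightarrow> 'p \<Rightarrow> 'p \<Rightarrow> ('k, 'n) module"
  where "HD \<equiv> pull_module p q lift"

context
  fixes k :: "('k, 'x) ring_scheme" and H :: "'o \<Rightarrow> 'o \<Rightarrow> ('k, 'm) module"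
  assumes linear: "linear_category k C H"
begin

interpretation L: linear_category k C H by (rule linear)

lemma carrier_pull:
  assumes "X \<in> Obj D" "Y \<in> Obj D"
  shows "carrier (HD H X Y) = Hom D X Y"
proof -
  have "f \<in> lift X Y ` Hom C (p X) (p Y)" if "f \<in> Hom D X Y" for f
    using that lift_q q_Hom by (metis image_eqI)
  then show ?thesis
    using assms lift_Hom by (auto simp: pull_module_simps L.carrier_Hom)
qed

lemma linear_category_D: "linear_category k D (HD H)"
proof (intro linear_category.intro linear_category_axioms.intro D.category_axioms L.is_cring)
  show "module k (HD H X Y)" if "X \<in> Obj D" "Y \<in> Obj D" for X Y
    using that by (intro module_pull_module L.Hom_module) (simp_all add: L.carrier_Hom q_lift)
  show "carrier (HD H X Y) = Hom D X Y" if "X \<in> Obj D" "Y \<in> Obj D" for X Y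
    using that by (rule carrier_pull)
next
  fix f g g' X Y Z assume "f \<in> Hom D X Y" "g \<in> Hom D Y Z" "g' \<in> Hom D Y Z"
  then show "(g \<oplus>\<^bsub>HD H Y Z\<^esub> g') \<cdot>\<^bsub>D\<^esub> f = (g \<cdot>\<^bsub>D\<^esub> f) \<oplus>\<^bsub>HD H X Z\<^esub> (g' \<cdot>\<^bsub>D\<^esub> f)"
    using L.Comp_add_left[of "q f" "p X" "p Y" "q g" "p Z" "q g'"]
    by (auto simp: Hom_def pull_module_simps intro!: q_inject)
next
  fix f f' g X Y Z assume "f \<in> Hom D X Y" "f' \<in> Hom D X Y" "g \<in> Hom D Y Z"
  then show "g \<cdot>\<^bsub>D\<^esub> (f \<oplus>\<^bsub>HD H X Y\<^esub> f') = (g \<cdot>\<^bsub>D\<^esub> f) \<oplus>\<^bsub>HD H X Z\<^esub> (g \<cdot>\<^bsub>D\<^esub> f')"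
    using L.Comp_add_right[of "q f" "p X" "p Y" "q f'" "q g" "p Z"]
    by (auto simp: Hom_def pull_module_simps intro!: q_inject)
next
  fix a f g X Y Z assume "a \<in> carrier k" "f \<in> Hom D X Y" "g \<in> Hom D Y Z"
  then show "(a \<odot>\<^bsub>HD H Y Z\<^esub> g) \<cdot>\<^bsub>D\<^esub> f = a \<odot>\<^bsub>HD H X Z\<^esub> (g \<cdot>\<^bsub>D\<^esub> f)"
    "g \<cdot>\<^bsub>D\<^esub> (a \<odot>\<^bsub>HD H X Y\<^esub> f) = a \<odot>\<^bsub>HD H X Z\<^esub> (g \<cdot>\<^bsub>D\<^esub> f)"
    using L.Comp_smult_left[of a "q f" "p X" "p Y" "q g" "p Z"]
      L.Comp_smult_right[of a "q f" "p X" "p Y" "q g" "p Z"]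
    by (auto simp: Hom_def pull_module_simps intro!: q_inject)
qed

lemma zero_object_D:
  assumes "zero_object C (p Z)" "Z \<in> Obj D" shows "zero_object D Z"
proof -
  have "\<exists>!f. f \<in> Hom D X Y" if "\<exists>!u. u \<in> Hom C (p X) (p Y)" "X \<in> Obj D" "Y \<in> Obj D" for X Y
    using that lift_Hom lift_q q_Hom by metis
  then show ?thesis using assms by (auto simp: zero_object_def)
qed

lemma direct_sum_D:
  assumes Y: "Y \<in> I \<rightarrow> Obj D" and P: "P \<in> Obj D" and "direct_sum C H I (\<lambda>i. p (Y i)) (p P)"
  shows "direct_sum D (HD H) I Y P"
proof -
  obtain inj proj where fin: "finite I"
    and inj: "\<And>i. i \<in> I \<Longrightarrow> inj i \<in> Hom C (p (Y i)) (p P)"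
    and proj: "\<And>i. i \<in> I \<Longrightarrow> proj i \<in> Hom C (p P) (p (Y i))"
    and same: "\<And>i. i \<in> I \<Longrightarrow> proj i \<cdot> inj i = \<iota> (p (Y i))"
    and diff: "\<And>i j. i \<in> I \<Longrightarrow> j \<in> I \<Longrightarrow> i \<noteq> j \<Longrightarrow> proj j \<cdot> inj i = \<zero>\<^bsub>H (p (Y i)) (p (Y j))\<^esub>"
    and total: "(\<Oplus>\<^bsub>H (p P) (p P)\<^esub> i \<in> I. inj i \<cdot> proj i) = \<iota> (p P)"
    using assms(3) unfolding direct_sum_def by blast
  have YI [simp]: "Y i \<in> Obj D" if "i \<in> I" for i using Y that by auto
  note Hom = inj[unfolded Hom_iff] proj[unfolded Hom_iff]
  let ?inj = "\<lambda>i. lift (Y i) P (inj i)" and ?proj = "\<lambda>i. lift P (Y i) (proj i)"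
  let ?A = "H (p P) (p P)" and ?B = "HD H P P"
  have "module k ?A" "module k ?B"
    using L.Hom_module linear_category.Hom_module[OF linear_category_D] P p_Obj by auto
  then interpret A: module k ?A + B: module k ?B .
  have "(\<Oplus>\<^bsub>?B\<^esub> i \<in> I. ?inj i \<cdot>\<^bsub>D\<^esub> ?proj i) = (\<Oplus>\<^bsub>?B\<^esub> i \<in> I. lift P P (inj i \<cdot> proj i))"
  proof (rule B.finsum_cong')
    show "?inj i \<cdot>\<^bsub>D\<^esub> ?proj i = lift P P (inj i \<cdot> proj i)" if "i \<in> I" for i
      by (rule q_inject) (use that P Hom in auto)
    show "(\<lambda>i. lift P P (inj i \<cdot> proj i)) \<in> I \<rightarrow> carrier ?B"
      using P Hom by (auto simp: carrier_pull Hom_def)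
  qed simp
  also have "\<dots> = lift P P (\<Oplus>\<^bsub>?A\<^esub> i \<in> I. inj i \<cdot> proj i)"
    by (rule finsum_additive[symmetric, where f = "\<lambda>i. inj i \<cdot> proj i"])
      (use P Hom fin in \<open>auto simp: pull_module_simps L.carrier_Hom Hom_def A.abelian_monoid_axioms
         B.abelian_monoid_axioms\<close>)
  also have "\<dots> = ident D P" using P total by (simp add: ident_lift)
  finally show ?thesis
    unfolding direct_sum_def using fin Y P Hom
    by (intro conjI exI[of _ ?inj] exI[of _ ?proj])
       (auto simp: Hom_def same diff pull_module_simps intro!: q_inject)
qed

text \<open>
  Universal properties transfer because every test object of \<open>C\<close> is the image of one of \<open>D\<close> and the
  hom sets agree.
\<close>

lemma is_kernel_D:
  assumes f: "f \<in> Arr D" and Z: "Z \<in> Obj D" and "is_kernel C H (q f) i" "Dom C i = p Z"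
  shows "is_kernel D (HD H) f (lift Z (Dom D f) i)"
proof -
  have i: "i \<in> Arr C" "Dom C i = p Z" "Cod C i = p (Dom D f)" "q f \<cdot> i = \<zero>\<^bsub>H (p Z) (p (Cod D f))\<^esub>"
    and U: "\<And>W u. \<lbrakk>W \<in> Obj C; u \<in> Arr C; Dom C u = W; Cod C u = p (Dom D f); q f \<cdot> u = \<zero>\<^bsub>H W (p (Cod D f))\<^esub>\<rbrakk>
        \<Longrightarrow> \<exists>!v. v \<in> Hom C W (p Z) \<and> i \<cdot> v = u"
    using assms by (auto simp: is_kernel_def Hom_iff)
  let ?i = "lift Z (Dom D f) i"
  have "\<exists>!v. v \<in> Hom D W Z \<and> ?i \<cdot>\<^bsub>D\<^esub> v = u"
    if W: "W \<in> Obj D" and u: "u \<in> Hom D W (Dom D f)" and 0: "f \<cdot>\<^bsub>D\<^esub> u = \<zero>\<^bsub>HD H W (Cod D f)\<^esub>" for W u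
  proof -
    have u': "u \<in> Arr D" "Dom D u = W" "Cod D u = Dom D f" using u by (auto simp: Hom_def)
    have "q f \<cdot> q u = q (f \<cdot>\<^bsub>D\<^esub> u)" using f u' by simp
    also have "\<dots> = \<zero>\<^bsub>H (p W) (p (Cod D f))\<^esub>" using f W unfolding 0 by (simp add: pull_module_simps)
    finally have "\<exists>!v. v \<in> Hom C (p W) (p Z) \<and> i \<cdot> v = q u"
      using f u' W by (intro U) simp_all
    then obtain v where v: "v \<in> Arr C" "Dom C v = p W" "Cod C v = p Z" "i \<cdot> v = q u"
      and unique: "\<And>v'. v' \<in> Hom C (p W) (p Z) \<Longrightarrow> i \<cdot> v' = q u \<Longrightarrow> v' = v"
      by (auto simp: Hom_iff)
    show ?thesis
    proof (rule ex1I[of _ "lift W Z v"])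
      show "lift W Z v \<in> Hom D W Z \<and> ?i \<cdot>\<^bsub>D\<^esub> lift W Z v = u"
        using v W Z f i u' by (auto simp: Hom_def intro!: q_inject)
      fix w assume w: "w \<in> Hom D W Z \<and> ?i \<cdot>\<^bsub>D\<^esub> w = u"
      then have "q u = i \<cdot> q w" using Z f i by (auto simp: Hom_def)
      then have "q w = v" using w unique q_Hom by auto
      then show "w = lift W Z v" using w lift_q by auto
    qed
  qed
  then show ?thesis
    using f Z i by (auto simp: is_kernel_def pull_module_simps intro!: q_inject)
qed

lemma is_cokernel_D:
  assumes f: "f \<in> Arr D" and Z: "Z \<in> Obj D" and "is_cokernel C H (q f) i" "Cod C i = p Z"
  shows "is_cokernel D (HD H) f (lift (Cod D f) Z i)"
proof -
  have i: "i \<in> Arr C" "Cod C i = p Z" "Dom C i = p (Cod D f)" "i \<cdot> q f = \<zero>\<^bsub>H (p (Dom D f)) (p Z)\<^esub>"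
    and U: "\<And>W u. \<lbrakk>W \<in> Obj C; u \<in> Arr C; Cod C u = W; Dom C u = p (Cod D f); u \<cdot> q f = \<zero>\<^bsub>H (p (Dom D f)) W\<^esub>\<rbrakk>
        \<Longrightarrow> \<exists>!v. v \<in> Hom C (p Z) W \<and> v \<cdot> i = u"
    using assms by (auto simp: is_cokernel_def Hom_iff)
  let ?i = "lift (Cod D f) Z i"
  have "\<exists>!v. v \<in> Hom D Z W \<and> v \<cdot>\<^bsub>D\<^esub> ?i = u"
    if W: "W \<in> Obj D" and u: "u \<in> Hom D (Cod D f) W" and 0: "u \<cdot>\<^bsub>D\<^esub> f = \<zero>\<^bsub>HD H (Dom D f) W\<^esub>" for W u
  proof -
    have u': "u \<in> Arr D" "Cod D u = W" "Dom D u = Cod D f" using u by (auto simp: Hom_def)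
    have "q u \<cdot> q f = q (u \<cdot>\<^bsub>D\<^esub> f)" using f u' by simp
    also have "\<dots> = \<zero>\<^bsub>H (p (Dom D f)) (p W)\<^esub>" using f W unfolding 0 by (simp add: pull_module_simps)
    finally have "\<exists>!v. v \<in> Hom C (p Z) (p W) \<and> v \<cdot> i = q u"
      using f u' W by (intro U) simp_all
    then obtain v where v: "v \<in> Arr C" "Dom C v = p Z" "Cod C v = p W" "v \<cdot> i = q u"
      and unique: "\<And>v'. v' \<in> Hom C (p Z) (p W) \<Longrightarrow> v' \<cdot> i = q u \<Longrightarrow> v' = v"
      by (auto simp: Hom_iff)
    show ?thesis
    proof (rule ex1I[of _ "lift Z W v"])
      show "lift Z W v \<in> Hom D Z W \<and> lift Z W v \<cdot>\<^bsub>D\<^esub> ?i = u"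
        using v W Z f i u' by (auto simp: Hom_def intro!: q_inject)
      fix w assume w: "w \<in> Hom D Z W \<and> w \<cdot>\<^bsub>D\<^esub> ?i = u"
      then have "q u = q w \<cdot> i" using Z f i by (auto simp: Hom_def)
      then have "q w = v" using w unique q_Hom by auto
      then show "w = lift Z W v" using w lift_q by auto
    qed
  qed
  then show ?thesis
    using f Z i by (auto simp: is_cokernel_def pull_module_simps intro!: q_inject)
qed

text \<open>
  Monomorphisms are tested against all objects of \<open>C\<close>, so this direction uses that the cover is
  surjective on objects.
\<close>

lemma q_mono:
  assumes "is_mono D f" shows "is_mono C (q f)"
  unfolding is_mono_def
proof (intro conjI ballI impI)
  have f: "f \<in> Arr D" using assms by (simp add: is_mono_def)
  then show "q f \<in> Arr C" by simp
  fix W u v assume "W \<in> Obj C" and uv: "u \<in> Hom C W (Dom C (q f))" "v \<in> Hom C W (Dom C (q f))" "q f \<cdot> u = q f \<cdot> v"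
  then obtain W' where W': "W' \<in> Obj D" "W = p W'" using image_Obj by auto
  let ?l = "lift W' (Dom D f)"
  have "f \<cdot>\<^bsub>D\<^esub> ?l u = f \<cdot>\<^bsub>D\<^esub> ?l v"
    by (rule q_inject) (use f W' uv in \<open>simp_all add: Hom_iff\<close>)
  then have "?l u = ?l v"
    using assms W' uv f unfolding is_mono_def by (auto simp: Hom_def)
  then have "q (?l u) = q (?l v)" by simp
  then show "u = v" using f W' uv by (simp add: Hom_iff)
qed

lemma q_epi:
  assumes "is_epi D f" shows "is_epi C (q f)"
  unfolding is_epi_def
proof (intro conjI ballI impI)
  have f: "f \<in> Arr D" using assms by (simp add: is_epi_def)
  then show "q f \<in> Arr C" by simp
  fix W u v assume "W \<in> Obj C" and uv: "u \<in> Hom C (Cod C (q f)) W" "v \<in> Hom C (Cod C (q f)) W" "u \<cdot> q f = v \<cdot> q f"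
  then obtain W' where W': "W' \<in> Obj D" "W = p W'" using image_Obj by auto
  let ?l = "lift (Cod D f) W'"
  have "?l u \<cdot>\<^bsub>D\<^esub> f = ?l v \<cdot>\<^bsub>D\<^esub> f"
    by (rule q_inject) (use f W' uv in \<open>simp_all add: Hom_iff\<close>)
  then have "?l u = ?l v"
    using assms W' uv f unfolding is_epi_def by (auto simp: Hom_def)
  then have "q (?l u) = q (?l v)" by simp
  then show "u = v" using f W' uv by (simp add: Hom_iff)
qed

end

lemma linear_abelian_category_D:
  assumes "linear_abelian_category k C H"
  shows "linear_abelian_category k D (HD H)"
proof -
  interpret A: linear_abelian_category k C H by fact
  note linear = A.linear_category_axioms
  interpret LD: linear_category k D "HD H" by (rule linear_category_D[OF linear])
  have onto: "\<exists>Z \<in> Obj D. X = p Z" if "X \<in> Obj C" for X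
    using that image_Obj by auto
  show ?thesis
  proof
    show "\<exists>Z. zero_object D Z"
      using A.ex_zero_object onto zero_object_D[OF linear] by (metis zero_object_def)
  next
    fix X Y assume XY: "X \<in> Obj D" "Y \<in> Obj D"
    then obtain P where P: "direct_sum C H (UNIV :: bool set) (\<lambda>b. if b then p X else p Y) P"
      using A.ex_binary_direct_sum p_Obj by metis
    then obtain P' where "P' \<in> Obj D" "P = p P'" using onto by (auto simp: direct_sum_def)
    with P XY show "\<exists>P. direct_sum D (HD H) (UNIV :: bool set) (\<lambda>b. if b then X else Y) P"
      by (intro exI[of _ P'] direct_sum_D[OF linear]) (auto simp: if_distrib[of p])
  next
    fix f assume f: "f \<in> Arr D"
    obtain i where i: "is_kernel C H (q f) i" using A.ex_kernel f q_Arr by metis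
    obtain Z where "Z \<in> Obj D" "Dom C i = p Z" using onto i by (metis arr_Obj(1) is_kernel_def)
    then show "\<exists>i. is_kernel D (HD H) f i" using is_kernel_D[OF linear f] i by blast
    obtain j where j: "is_cokernel C H (q f) j" using A.ex_cokernel f q_Arr by metis
    obtain Z where "Z \<in> Obj D" "Cod C j = p Z" using onto j by (metis arr_Obj(2) is_cokernel_def)
    then show "\<exists>j. is_cokernel D (HD H) f j" using is_cokernel_D[OF linear f] j by blast
  next
    fix f assume m: "is_mono D f"
    then have f: "f \<in> Arr D" by (simp add: is_mono_def)
    obtain g where g: "is_kernel C H g (q f)" using A.mono_is_kernel q_mono[OF linear m] by blast
    then have g': "g \<in> Arr C" "Dom C g = p (Cod D f)" using f by (auto simp: is_kernel_def)
    then obtain Z where Z: "Z \<in> Obj D" "Cod C g = p Z" using onto by (metis arr_Obj(2))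
    let ?g = "lift (Cod D f) Z g"
    have "is_kernel D (HD H) ?g (lift (Dom D f) (Dom D ?g) (q f))"
      using f g g' Z by (intro is_kernel_D[OF linear]) simp_all
    then show "\<exists>g. is_kernel D (HD H) g f"
      using f g' Z lift_q[of f "Dom D f" "Cod D f"] by (auto simp: Hom_def)
  next
    fix f assume m: "is_epi D f"
    then have f: "f \<in> Arr D" by (simp add: is_epi_def)
    obtain g where g: "is_cokernel C H g (q f)" using A.epi_is_cokernel q_epi[OF linear m] by blast
    then have g': "g \<in> Arr C" "Cod C g = p (Dom D f)" using f by (auto simp: is_cokernel_def)
    then obtain Z where Z: "Z \<in> Obj D" "Dom C g = p Z" using onto by (metis arr_Obj(1))
    let ?g = "lift Z (Dom D f) g"
    have "is_cokernel D (HD H) ?g (lift (Cod D ?g) (Cod D f) (q f))"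
      using f g g' Z by (intro is_cokernel_D[OF linear]) simp_all
    then show "\<exists>g. is_cokernel D (HD H) g f"
      using f g' Z lift_q[of f "Dom D f" "Cod D f"] by (auto simp: Hom_def)
  qed
qed

end

lemma (in category) category_full_subcat: "category (full_subcat C U)"
  by standard (auto simp: Hom_def)

text \<open>
  Homogeneous components are full subcategories, and this reduces the linear abelian structure on them to
  the one on the components of the original category.
\<close>

lemma (in fully_faithful_cover) cover_full_subcat:
  assumes "T \<subseteq> Obj D" "p ` T = U"
  shows "fully_faithful_cover (full_subcat C U) (full_subcat D T) p q lift"
proof -
  have "T \<inter> Obj D = T" "Obj C \<inter> U = U" using assms image_Obj by auto
  moreover have "Hom (full_subcat C U) X Y = Hom C X Y" if "X \<in> U" "Y \<in> U" for X Y
    using that by (auto simp: Hom_def)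
  moreover have "Hom (full_subcat D T) X Y = (if X \<in> T \<and> Y \<in> T then Hom D X Y else {})" for X Y
    by (auto simp: Hom_def)
  moreover have "X \<in> Obj D" if "X \<in> T" for X using that assms(1) by blast
  moreover have "p X \<in> U" if "X \<in> T" for X using that assms(2) by blast
  ultimately show ?thesis
    using assms q_lift lift_Hom q_Hom lift_q ident_lift
    by (intro fully_faithful_cover.intro fully_faithful_cover_axioms.intro category_full_subcat)
       (auto simp: Int_commute arr_Obj_D Comp_lift split: if_splits)
qed

section \<open>Equivariant families\<close>

context monoidal_G_category
begin

lemma act_simps [simp]:
  assumes "g \<in> carrier G"
  shows "X \<in> Obj C \<Longrightarrow> act_obj C g X \<in> Obj C"
    and "f \<in> Arr C \<Longrightarrow> act_arr C g f \<in> Arr C"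
    and "f \<in> Arr C \<Longrightarrow> Dom C (act_arr C g f) = act_obj C g (Dom C f)"
    and "f \<in> Arr C \<Longrightarrow> Cod C (act_arr C g f) = act_obj C g (Cod C f)"
    and "X \<in> Obj C \<Longrightarrow> act_arr C g (\<iota> X) = \<iota> (act_obj C g X)"
    and "\<lbrakk>f \<in> Arr C; f' \<in> Arr C; Dom C f' = Cod C f\<rbrakk>
      \<Longrightarrow> act_arr C g (f' \<cdot> f) = act_arr C g f' \<cdot> act_arr C g f"
  using act_functor[OF assms] by (auto simp: is_functor_def act_def Hom_def)

lemma act_iso [simp]:
  assumes "g \<in> carrier G" "is_iso C f"
  shows "is_iso C (act_arr C g f)" "act_arr C g (inv_arrow C f) = inv_arrow C (act_arr C g f)"
proof -
  have f: "f \<in> Arr C" by (rule iso_Arr) fact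
  have "inverse_arrows C (act_arr C g f) (act_arr C g (inv_arrow C f))"
    using assms f by (simp add: inverse_arrows_def Hom_iff flip: act_simps(6))
  then show "is_iso C (act_arr C g f)" "act_arr C g (inv_arrow C f) = inv_arrow C (act_arr C g f)"
    using inv_arrow_eq by (auto simp: is_iso_def)
qed

lemma phi_simps [simp]:
  assumes "g \<in> carrier G" "h \<in> carrier G" "X \<in> Obj C"
  shows "phi C g h X \<in> Arr C" "Dom C (phi C g h X) = act_obj C (g \<otimes>\<^bsub>G\<^esub> h) X"
    "Cod C (phi C g h X) = act_obj C g (act_obj C h X)" "is_iso C (phi C g h X)"
  using phi_natural[OF assms(1,2)] assms(3)
  by (auto simp: natural_iso_def act_def comp_functor_def Hom_iff)

lemma phi_nat:
  assumes "g \<in> carrier G" "h \<in> carrier G" "f \<in> Arr C"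
  shows "phi C g h (Cod C f) \<cdot> act_arr C (g \<otimes>\<^bsub>G\<^esub> h) f
    = act_arr C g (act_arr C h f) \<cdot> phi C g h (Dom C f)"
  using phi_natural[OF assms(1,2)] assms(3)
  by (auto simp: natural_iso_def act_def comp_functor_def)

lemma psi_simps [simp]:
  assumes "g \<in> carrier G" "X \<in> Obj C" "Y \<in> Obj C"
  shows "psi C g X Y \<in> Arr C" "Dom C (psi C g X Y) = act_obj C g (X \<otimes>\<^sub>o Y)"
    "Cod C (psi C g X Y) = act_obj C g X \<otimes>\<^sub>o act_obj C g Y" "is_iso C (psi C g X Y)"
  using psi_comparison[OF assms(1)] assms(2,3)
  by (auto simp: tensor_comparison_def act_def Hom_iff)

lemma psi_nat:
  assumes "g \<in> carrier G" "f \<in> Arr C" "f' \<in> Arr C"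
  shows "psi C g (Cod C f) (Cod C f') \<cdot> act_arr C g (f \<otimes>\<^sub>a f')
    = (act_arr C g f \<otimes>\<^sub>a act_arr C g f') \<cdot> psi C g (Dom C f) (Dom C f')"
  using psi_comparison[OF assms(1)] assms(2,3)
  by (auto simp: tensor_comparison_def act_def)

lemma psi_assoc:
  assumes "g \<in> carrier G" "X \<in> Obj C" "Y \<in> Obj C" "Z \<in> Obj C"
  shows "(psi C g X Y \<otimes>\<^sub>a \<iota> (act_obj C g Z)) \<cdot> psi C g (X \<otimes>\<^sub>o Y) Z
    = (\<iota> (act_obj C g X) \<otimes>\<^sub>a psi C g Y Z) \<cdot> psi C g X (Y \<otimes>\<^sub>o Z)"
  using psi_comparison[OF assms(1)] assms(2-4)
  by (auto simp: tensor_comparison_def act_def)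

text \<open>
  A family \<open>X\<close> consists of objects \<open>fst X k\<close> and isomorphisms
  \<open>snd X g h : g\<^sub>*(X\<^sub>h) \<rightarrow> X\<^sub>g\<^sub>h\<close> that are compatible with \<open>\<phi>\<close>; it is the same as an equivariant
  functor from the discrete category \<open>G\<close>, on which \<open>G\<close> acts by left multiplication, to \<open>C\<close>.  The
  values outside \<open>carrier G\<close> are fixed because the strictness equations are equations between families.
  In this context the type variables \<open>'c\<close>, \<open>'a\<close> and \<open>'b\<close> stand for group elements, objects and arrows.
\<close>

definition equivariant :: "('c, 'a, 'b) family_obj \<Rightarrow> bool" where
  "equivariant X \<longleftrightarrow>
     fst X \<in> extensional (carrier G) \<and> snd X \<in> extensional (carrier G)
     \<and> (\<forall>g \<in> carrier G. snd X g \<in> extensional (carrier G))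
     \<and> (\<forall>k \<in> carrier G. fst X k \<in> Obj C)
     \<and> (\<forall>g \<in> carrier G. \<forall>h \<in> carrier G.
          snd X g h \<in> Hom C (act_obj C g (fst X h)) (fst X (g \<otimes>\<^bsub>G\<^esub> h)) \<and> is_iso C (snd X g h))
     \<and> (\<forall>g \<in> carrier G. \<forall>h \<in> carrier G. \<forall>k \<in> carrier G.
          snd X (g \<otimes>\<^bsub>G\<^esub> h) k = snd X g (h \<otimes>\<^bsub>G\<^esub> k) \<cdot> act_arr C g (snd X h k) \<cdot> phi C g h (fst X k))"

lemma equivariantI:
  assumes "fst X \<in> extensional (carrier G)" "snd X \<in> extensional (carrier G)"
    and "\<And>g. g \<in> carrier G \<Longrightarrow> snd X g \<in> extensional (carrier G)"
    and "\<And>k. k \<in> carrier G \<Longrightarrow> fst X k \<in> Obj C"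
    and "\<And>g h. \<lbrakk>g \<in> carrier G; h \<in> carrier G\<rbrakk> \<Longrightarrow> is_iso C (snd X g h)"
    and "\<And>g h. \<lbrakk>g \<in> carrier G; h \<in> carrier G\<rbrakk> \<Longrightarrow> Dom C (snd X g h) = act_obj C g (fst X h)"
    and "\<And>g h. \<lbrakk>g \<in> carrier G; h \<in> carrier G\<rbrakk> \<Longrightarrow> Cod C (snd X g h) = fst X (g \<otimes>\<^bsub>G\<^esub> h)"
    and "\<And>g h k. \<lbrakk>g \<in> carrier G; h \<in> carrier G; k \<in> carrier G\<rbrakk> \<Longrightarrow>
          snd X (g \<otimes>\<^bsub>G\<^esub> h) k = snd X g (h \<otimes>\<^bsub>G\<^esub> k) \<cdot> act_arr C g (snd X h k) \<cdot> phi C g h (fst X k)"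
  shows "equivariant X"
  unfolding equivariant_def Hom_iff
  by (intro conjI ballI) (use assms iso_Arr in \<open>simp_all only:\<close>)

lemma equivariant_eqI:
  assumes "equivariant X" "equivariant Y"
    and "\<And>k. k \<in> carrier G \<Longrightarrow> fst X k = fst Y k"
    and "\<And>g h. g \<in> carrier G \<Longrightarrow> h \<in> carrier G \<Longrightarrow> snd X g h = snd Y g h"
  shows "X = Y"
proof (rule prod_eqI)
  show "fst X = fst Y"
    using assms by (intro extensionalityI[of _ "carrier G"]) (auto simp: equivariant_def)
  have "snd X g = snd Y g" if "g \<in> carrier G" for g
    using assms that by (intro extensionalityI[of _ "carrier G"]) (auto simp: equivariant_def)
  then show "snd X = snd Y"
    using assms by (intro extensionalityI[of _ "carrier G"]) (auto simp: equivariant_def)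
qed

lemma equivariant_simps [simp]:
  assumes "equivariant X"
  shows "k \<in> carrier G \<Longrightarrow> fst X k \<in> Obj C"
    and "\<lbrakk>g \<in> carrier G; h \<in> carrier G\<rbrakk> \<Longrightarrow> snd X g h \<in> Arr C"
    and "\<lbrakk>g \<in> carrier G; h \<in> carrier G\<rbrakk> \<Longrightarrow> Dom C (snd X g h) = act_obj C g (fst X h)"
    and "\<lbrakk>g \<in> carrier G; h \<in> carrier G\<rbrakk> \<Longrightarrow> Cod C (snd X g h) = fst X (g \<otimes>\<^bsub>G\<^esub> h)"
    and "\<lbrakk>g \<in> carrier G; h \<in> carrier G\<rbrakk> \<Longrightarrow> is_iso C (snd X g h)"
  using assms by (auto simp: equivariant_def Hom_iff)

lemma cocycle:
  assumes "equivariant X" "g \<in> carrier G" "h \<in> carrier G" "k \<in> carrier G"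
  shows "snd X (g \<otimes>\<^bsub>G\<^esub> h) k = snd X g (h \<otimes>\<^bsub>G\<^esub> k) \<cdot> act_arr C g (snd X h k) \<cdot> phi C g h (fst X k)"
  using assms unfolding equivariant_def by blast

text \<open>
  The cocycle condition at \<open>g = h = \<one>\<close> makes the structure arrow idempotent, and it is invertible.
\<close>

lemma structure_one [simp]:
  assumes "equivariant X" "h \<in> carrier G"
  shows "snd X \<one>\<^bsub>G\<^esub> h = \<iota> (fst X h)"
proof -
  have "snd X \<one>\<^bsub>G\<^esub> h \<cdot> snd X \<one>\<^bsub>G\<^esub> h = snd X \<one>\<^bsub>G\<^esub> h"
    using cocycle[OF assms(1), of "\<one>\<^bsub>G\<^esub>" "\<one>\<^bsub>G\<^esub>" h] assms
    by (simp add: act_one_obj act_one_arr phi_one_left)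
  then show ?thesis
    using idempotent_iso[of "snd X \<one>\<^bsub>G\<^esub> h"] assms by (simp add: act_one_obj)
qed

definition tensor_fam :: "('c, 'a, 'b) family_obj \<Rightarrow> ('c, 'a, 'b) family_obj \<Rightarrow> ('c, 'a, 'b) family_obj"
  where "tensor_fam X Y =
    ((\<lambda>k \<in> carrier G. fst X k \<otimes>\<^sub>o fst Y k),
     (\<lambda>g \<in> carrier G. \<lambda>h \<in> carrier G. (snd X g h \<otimes>\<^sub>a snd Y g h) \<cdot> psi C g (fst X h) (fst Y h)))"

definition unit_fam :: "('c, 'a, 'b) family_obj" where
  "unit_fam = ((\<lambda>k \<in> carrier G. \<I>), (\<lambda>g \<in> carrier G. \<lambda>h \<in> carrier G. \<iota> \<I>))"

text \<open>
  The group acts on indices from the right.  Right translation commutes with the left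
  multiplication that the structure arrows use, and this action involves neither \<open>\<phi>\<close> nor \<open>\<psi>\<close>.
\<close>

definition shift_fam :: "'c \<Rightarrow> ('c, 'a, 'b) family_obj \<Rightarrow> ('c, 'a, 'b) family_obj" where
  "shift_fam a X =
    ((\<lambda>k \<in> carrier G. fst X (k \<otimes>\<^bsub>G\<^esub> a)),
     (\<lambda>g \<in> carrier G. \<lambda>h \<in> carrier G. snd X g (h \<otimes>\<^bsub>G\<^esub> a)))"

text \<open>
  The family generated by an object of \<open>C\<close>.  For it the cocycle condition is the associativity of \<open>\<phi>\<close>.
\<close>

definition orbit_fam :: "'a \<Rightarrow> ('c, 'a, 'b) family_obj" where
  "orbit_fam X =
    ((\<lambda>k \<in> carrier G. act_obj C k X),
     (\<lambda>g \<in> carrier G. \<lambda>h \<in> carrier G. inv_arrow C (phi C g h X)))"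

lemma family_simps [simp]:
  "k \<in> carrier G \<Longrightarrow> fst (tensor_fam X Y) k = fst X k \<otimes>\<^sub>o fst Y k"
  "\<lbrakk>g \<in> carrier G; h \<in> carrier G\<rbrakk> \<Longrightarrow>
    snd (tensor_fam X Y) g h = (snd X g h \<otimes>\<^sub>a snd Y g h) \<cdot> psi C g (fst X h) (fst Y h)"
  "k \<in> carrier G \<Longrightarrow> fst unit_fam k = \<I>"
  "\<lbrakk>g \<in> carrier G; h \<in> carrier G\<rbrakk> \<Longrightarrow> snd unit_fam g h = \<iota> \<I>"
  "k \<in> carrier G \<Longrightarrow> fst (shift_fam a X) k = fst X (k \<otimes>\<^bsub>G\<^esub> a)"
  "\<lbrakk>g \<in> carrier G; h \<in> carrier G\<rbrakk> \<Longrightarrow> snd (shift_fam a X) g h = snd X g (h \<otimes>\<^bsub>G\<^esub> a)"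
  "k \<in> carrier G \<Longrightarrow> fst (orbit_fam Z) k = act_obj C k Z"
  "\<lbrakk>g \<in> carrier G; h \<in> carrier G\<rbrakk> \<Longrightarrow> snd (orbit_fam Z) g h = inv_arrow C (phi C g h Z)"
  by (simp_all add: tensor_fam_def unit_fam_def shift_fam_def orbit_fam_def)

lemma family_extensional:
  "fst (tensor_fam X Y) \<in> extensional (carrier G)" "snd (tensor_fam X Y) \<in> extensional (carrier G)"
  "g \<in> carrier G \<Longrightarrow> snd (tensor_fam X Y) g \<in> extensional (carrier G)"
  "fst unit_fam \<in> extensional (carrier G)" "snd unit_fam \<in> extensional (carrier G)"
  "g \<in> carrier G \<Longrightarrow> snd unit_fam g \<in> extensional (carrier G)"
  "fst (shift_fam a X) \<in> extensional (carrier G)" "snd (shift_fam a X) \<in> extensional (carrier G)"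
  "g \<in> carrier G \<Longrightarrow> snd (shift_fam a X) g \<in> extensional (carrier G)"
  "fst (orbit_fam Z) \<in> extensional (carrier G)" "snd (orbit_fam Z) \<in> extensional (carrier G)"
  "g \<in> carrier G \<Longrightarrow> snd (orbit_fam Z) g \<in> extensional (carrier G)"
  by (simp_all add: tensor_fam_def unit_fam_def shift_fam_def orbit_fam_def)

text \<open>
  The tensor product is formed componentwise, with \<open>\<psi>\<close> inserted into the structure arrows.  The
  cocycle condition is the compatibility of \<open>\<phi>\<close> with \<open>\<psi>\<close> together with naturality of \<open>\<psi>\<close>.
\<close>

lemma equivariant_tensor [simp]:
  assumes X: "equivariant X" and Y: "equivariant Y"
  shows "equivariant (tensor_fam X Y)"
proof -
  have "((snd X (g \<otimes>\<^bsub>G\<^esub> h) k \<otimes>\<^sub>a snd Y (g \<otimes>\<^bsub>G\<^esub> h) k) \<cdot> psi C (g \<otimes>\<^bsub>G\<^esub> h) (fst X k) (fst Y k))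
    = ((snd X g (h \<otimes>\<^bsub>G\<^esub> k) \<otimes>\<^sub>a snd Y g (h \<otimes>\<^bsub>G\<^esub> k)) \<cdot> psi C g (fst X (h \<otimes>\<^bsub>G\<^esub> k)) (fst Y (h \<otimes>\<^bsub>G\<^esub> k)))
      \<cdot> act_arr C g ((snd X h k \<otimes>\<^sub>a snd Y h k) \<cdot> psi C h (fst X k) (fst Y k))
      \<cdot> phi C g h (fst X k \<otimes>\<^sub>o fst Y k)"
    if ghk: "g \<in> carrier G" "h \<in> carrier G" "k \<in> carrier G" for g h k
  proof -
    let ?a = "snd X g (h \<otimes>\<^bsub>G\<^esub> k)" and ?b = "snd Y g (h \<otimes>\<^bsub>G\<^esub> k)"
    let ?c = "snd X h k" and ?d = "snd Y h k"
    let ?x = "fst X k" and ?y = "fst Y k"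
    have nat: "psi C g (fst X (h \<otimes>\<^bsub>G\<^esub> k)) (fst Y (h \<otimes>\<^bsub>G\<^esub> k)) \<cdot> act_arr C g (?c \<otimes>\<^sub>a ?d)
      = (act_arr C g ?c \<otimes>\<^sub>a act_arr C g ?d) \<cdot> psi C g (act_obj C h ?x) (act_obj C h ?y)"
      using psi_nat[of g ?c ?d] ghk X Y by simp
    have "(snd X (g \<otimes>\<^bsub>G\<^esub> h) k \<otimes>\<^sub>a snd Y (g \<otimes>\<^bsub>G\<^esub> h) k) \<cdot> psi C (g \<otimes>\<^bsub>G\<^esub> h) ?x ?y
      = ((?a \<cdot> act_arr C g ?c) \<otimes>\<^sub>a (?b \<cdot> act_arr C g ?d))
        \<cdot> ((phi C g h ?x \<otimes>\<^sub>a phi C g h ?y) \<cdot> psi C (g \<otimes>\<^bsub>G\<^esub> h) ?x ?y)"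
      using ghk X Y by (simp add: cocycle m_assoc)
    also have "\<dots> = (?a \<otimes>\<^sub>a ?b) \<cdot> (((act_arr C g ?c \<otimes>\<^sub>a act_arr C g ?d)
        \<cdot> psi C g (act_obj C h ?x) (act_obj C h ?y)) \<cdot> act_arr C g (psi C h ?x ?y)
        \<cdot> phi C g h (?x \<otimes>\<^sub>o ?y))"
      using ghk X Y by (simp add: phi_psi)
    also have "\<dots> = ((?a \<otimes>\<^sub>a ?b) \<cdot> psi C g (fst X (h \<otimes>\<^bsub>G\<^esub> k)) (fst Y (h \<otimes>\<^bsub>G\<^esub> k)))
      \<cdot> act_arr C g ((?c \<otimes>\<^sub>a ?d) \<cdot> psi C h ?x ?y) \<cdot> phi C g h (?x \<otimes>\<^sub>o ?y)"
      unfolding nat[symmetric] using ghk X Y by simp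
    finally show ?thesis .
  qed
  note cocycle_tensor = this
  show ?thesis
  proof (rule equivariantI)
    fix g h k assume ghk: "g \<in> carrier G" "h \<in> carrier G" "k \<in> carrier G"
    then show "snd (tensor_fam X Y) (g \<otimes>\<^bsub>G\<^esub> h) k = snd (tensor_fam X Y) g (h \<otimes>\<^bsub>G\<^esub> k)
        \<cdot> act_arr C g (snd (tensor_fam X Y) h k) \<cdot> phi C g h (fst (tensor_fam X Y) k)"
      using cocycle_tensor[OF ghk] by (simp only: family_simps m_closed)
  qed (use X Y in \<open>simp_all add: family_extensional\<close>)
qed

text \<open>
  On the unit object \<open>\<psi>\<close> is an identity, so the compatibility of \<open>\<phi>\<close> with \<open>\<psi>\<close> says that
  \<open>\<phi>(g,h) \<otimes> \<phi>(g,h) = \<phi>(g,h)\<close>; by interchange the left side is also \<open>\<phi>(g,h) \<cdot> \<phi>(g,h)\<close>.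
\<close>

lemma phi_unit [simp]:
  assumes "g \<in> carrier G" "h \<in> carrier G"
  shows "phi C g h \<I> = \<iota> \<I>"
proof -
  let ?f = "phi C g h \<I>"
  have f: "?f \<in> Arr C" "is_iso C ?f" "Dom C ?f = \<I>" "Cod C ?f = \<I>"
    using assms by (simp_all add: act_unit)
  have "?f \<cdot> ?f = (?f \<otimes>\<^sub>a \<iota> \<I>) \<cdot> (\<iota> \<I> \<otimes>\<^sub>a ?f)"
    using f by (simp del: interchange)
  also have "\<dots> = ?f \<otimes>\<^sub>a ?f"
    using f by (simp del: tensor_arr_unit)
  also have "\<dots> = ?f"
    using phi_psi[of g h \<I> \<I>] f assms by (simp add: psi_unit_right act_unit)
  finally show ?thesis using idempotent_iso[of ?f] f by simp
qed

lemma equivariant_unit [simp]: "equivariant unit_fam"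
  unfolding equivariant_def
  by (auto simp: family_extensional Hom_iff act_unit)

lemma equivariant_shift [simp]:
  assumes "equivariant X" "a \<in> carrier G"
  shows "equivariant (shift_fam a X)"
  using assms unfolding equivariant_def
  by (auto simp: family_extensional Hom_iff m_assoc)

lemma equivariant_orbit [simp]:
  assumes "Z \<in> Obj C"
  shows "equivariant (orbit_fam Z)"
proof -
  have "inv_arrow C (phi C (g \<otimes>\<^bsub>G\<^esub> h) k Z)
      = inv_arrow C (phi C g (h \<otimes>\<^bsub>G\<^esub> k) Z) \<cdot> inv_arrow C (act_arr C g (phi C h k Z)) \<cdot> phi C g h (act_obj C k Z)"
    if "g \<in> carrier G" "h \<in> carrier G" "k \<in> carrier G" for g h k
  proof (rule iso_cancel_right)
    show "is_iso C (phi C (g \<otimes>\<^bsub>G\<^esub> h) k Z)" using that assms by simp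
    show "inv_arrow C (phi C (g \<otimes>\<^bsub>G\<^esub> h) k Z) \<cdot> phi C (g \<otimes>\<^bsub>G\<^esub> h) k Z
      = (inv_arrow C (phi C g (h \<otimes>\<^bsub>G\<^esub> k) Z) \<cdot> inv_arrow C (act_arr C g (phi C h k Z)) \<cdot> phi C g h (act_obj C k Z))
        \<cdot> phi C (g \<otimes>\<^bsub>G\<^esub> h) k Z"
      using that assms by (simp add: m_assoc phi_assoc)
  qed (use that assms in \<open>simp_all add: m_assoc\<close>)
  then show ?thesis
    using assms unfolding equivariant_def
    by (auto simp: family_extensional Hom_iff m_assoc)
qed

text \<open>
  Associativity holds on the nose because the tensor product of \<open>C\<close> is strict and \<open>\<psi>\<close> satisfies its
  own associativity constraint.
\<close>

lemma tensor_fam_assoc: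
  assumes "equivariant X" "equivariant Y" "equivariant Z"
  shows "tensor_fam (tensor_fam X Y) Z = tensor_fam X (tensor_fam Y Z)"
proof (rule equivariant_eqI)
  fix g h assume gh: "g \<in> carrier G" "h \<in> carrier G"
  let ?x = "fst X h" and ?y = "fst Y h" and ?z = "fst Z h"
  have "(((snd X g h \<otimes>\<^sub>a snd Y g h) \<cdot> psi C g ?x ?y) \<otimes>\<^sub>a snd Z g h) \<cdot> psi C g (?x \<otimes>\<^sub>o ?y) ?z
    = (snd X g h \<otimes>\<^sub>a snd Y g h \<otimes>\<^sub>a snd Z g h)
      \<cdot> (psi C g ?x ?y \<otimes>\<^sub>a \<iota> (act_obj C g ?z)) \<cdot> psi C g (?x \<otimes>\<^sub>o ?y) ?z"
    using gh assms by (simp del: tensor_arr_assoc)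
  also have "\<dots> = (snd X g h \<otimes>\<^sub>a (snd Y g h \<otimes>\<^sub>a snd Z g h))
      \<cdot> (\<iota> (act_obj C g ?x) \<otimes>\<^sub>a psi C g ?y ?z) \<cdot> psi C g ?x (?y \<otimes>\<^sub>o ?z)"
    using gh assms by (simp add: psi_assoc del: interchange)
  finally show "snd (tensor_fam (tensor_fam X Y) Z) g h = snd (tensor_fam X (tensor_fam Y Z)) g h"
    using gh assms by simp
qed (use assms in simp_all)

lemma tensor_fam_unit:
  assumes "equivariant X"
  shows "tensor_fam unit_fam X = X" "tensor_fam X unit_fam = X"
  using assms by (auto intro!: equivariant_eqI simp: psi_unit_left psi_unit_right act_unit)

lemma shift_fam_tensor:
  assumes "equivariant X" "equivariant Y" "a \<in> carrier G"
  shows "shift_fam a (tensor_fam X Y) = tensor_fam (shift_fam a X) (shift_fam a Y)"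
  using assms by (intro equivariant_eqI) simp_all

lemma shift_fam_mult:
  assumes "equivariant X" "a \<in> carrier G" "b \<in> carrier G"
  shows "shift_fam a (shift_fam b X) = shift_fam (a \<otimes>\<^bsub>G\<^esub> b) X"
  using assms by (intro equivariant_eqI) (simp_all add: m_assoc)

lemma shift_fam_one: "equivariant X \<Longrightarrow> shift_fam \<one>\<^bsub>G\<^esub> X = X"
  by (intro equivariant_eqI) simp_all

lemma shift_fam_unit: "a \<in> carrier G \<Longrightarrow> shift_fam a unit_fam = unit_fam"
  by (intro equivariant_eqI) simp_all

end

section \<open>Translation of arrows and the braiding of equivariant families\<close>

context monoidal_G_category
begin

text \<open>
  An arrow of families is an arrow between their components at \<open>\<one>\<close>; it has a unique extension to all
  components that is compatible with the structure arrows.  This is the component at \<open>g\<close> of that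
  extension, which is at the same time the component at \<open>\<one>\<close> of the arrow shifted by \<open>g\<close>.
\<close>

definition translate ::
  "'c \<Rightarrow> ('c, 'a, 'b) family_obj \<Rightarrow> ('c, 'a, 'b) family_obj \<Rightarrow> 'b \<Rightarrow> 'b" where
  "translate g X Y f = snd Y g \<one>\<^bsub>G\<^esub> \<cdot> act_arr C g f \<cdot> inv_arrow C (snd X g \<one>\<^bsub>G\<^esub>)"

lemma translate_simps [simp]:
  assumes "equivariant X" "equivariant Y" "g \<in> carrier G"
    and "f \<in> Arr C" "Dom C f = fst X \<one>\<^bsub>G\<^esub>" "Cod C f = fst Y \<one>\<^bsub>G\<^esub>"
  shows "translate g X Y f \<in> Arr C" "Dom C (translate g X Y f) = fst X g"
    "Cod C (translate g X Y f) = fst Y g"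
    "translate g X Y f \<cdot> snd X g \<one>\<^bsub>G\<^esub> = snd Y g \<one>\<^bsub>G\<^esub> \<cdot> act_arr C g f"
  using assms by (simp_all add: translate_def)

text \<open>
  All identities between translated arrows follow from this characterisation, since the structure
  arrow \<open>snd X g \<one>\<close> is invertible.
\<close>

lemma translate_unique:
  assumes "equivariant X" "equivariant Y" "g \<in> carrier G"
    and "f \<in> Arr C" "Dom C f = fst X \<one>\<^bsub>G\<^esub>" "Cod C f = fst Y \<one>\<^bsub>G\<^esub>"
    and "f' \<in> Arr C" "Dom C f' = fst X g"
    and "f' \<cdot> snd X g \<one>\<^bsub>G\<^esub> = snd Y g \<one>\<^bsub>G\<^esub> \<cdot> act_arr C g f"
  shows "translate g X Y f = f'"
  by (rule iso_cancel_right[where h = "snd X g \<one>\<^bsub>G\<^esub>"]) (use assms in simp_all)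

lemma translate_ident:
  assumes "equivariant X" "g \<in> carrier G"
  shows "translate g X X (\<iota> (fst X \<one>\<^bsub>G\<^esub>)) = \<iota> (fst X g)"
  using assms by (simp add: translate_def)

lemma translate_Comp:
  assumes "equivariant X" "equivariant Y" "equivariant Z" "g \<in> carrier G"
    and "f \<in> Arr C" "Dom C f = fst X \<one>\<^bsub>G\<^esub>" "Cod C f = fst Y \<one>\<^bsub>G\<^esub>"
    and "f' \<in> Arr C" "Dom C f' = fst Y \<one>\<^bsub>G\<^esub>" "Cod C f' = fst Z \<one>\<^bsub>G\<^esub>"
  shows "translate g X Z (f' \<cdot> f) = translate g Y Z f' \<cdot> translate g X Y f"
  using assms by (simp add: translate_def)

lemma translate_one:
  assumes "equivariant X" "equivariant Y"
    and "f \<in> Arr C" "Dom C f = fst X \<one>\<^bsub>G\<^esub>" "Cod C f = fst Y \<one>\<^bsub>G\<^esub>"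
  shows "translate \<one>\<^bsub>G\<^esub> X Y f = f"
  using assms by (simp add: translate_def act_one_arr)

text \<open>
  Strictness of the action on arrows.  The cocycle condition expresses the structure arrows at
  \<open>(g \<otimes> h, \<one>)\<close> through those used by the iterated translation, up to \<open>\<phi>(g,h)\<close>, and naturality of
  \<open>\<phi>\<close> moves this factor past the arrow.
\<close>

lemma translate_mult:
  assumes XY: "equivariant X" "equivariant Y" and gh: "g \<in> carrier G" "h \<in> carrier G"
    and f: "f \<in> Arr C" "Dom C f = fst X \<one>\<^bsub>G\<^esub>" "Cod C f = fst Y \<one>\<^bsub>G\<^esub>"
  shows "translate g (shift_fam h X) (shift_fam h Y) (translate h X Y f) = translate (g \<otimes>\<^bsub>G\<^esub> h) X Y f"
proof (rule translate_unique[symmetric])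
  have nat: "phi C g h (fst Y \<one>\<^bsub>G\<^esub>) \<cdot> act_arr C (g \<otimes>\<^bsub>G\<^esub> h) f
    = act_arr C g (act_arr C h f) \<cdot> phi C g h (fst X \<one>\<^bsub>G\<^esub>)"
    using phi_nat[OF gh f(1)] f by simp
  show "translate g (shift_fam h X) (shift_fam h Y) (translate h X Y f) \<cdot> snd X (g \<otimes>\<^bsub>G\<^esub> h) \<one>\<^bsub>G\<^esub>
    = snd Y (g \<otimes>\<^bsub>G\<^esub> h) \<one>\<^bsub>G\<^esub> \<cdot> act_arr C (g \<otimes>\<^bsub>G\<^esub> h) f"
    using XY gh f by (simp add: cocycle translate_def nat)
qed (use assms in simp_all)

lemma translate_tensor:
  assumes XY: "equivariant X" "equivariant Y" "equivariant X'" "equivariant Y'" and g: "g \<in> carrier G"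
    and f: "f \<in> Arr C" "Dom C f = fst X \<one>\<^bsub>G\<^esub>" "Cod C f = fst Y \<one>\<^bsub>G\<^esub>"
    and f': "f' \<in> Arr C" "Dom C f' = fst X' \<one>\<^bsub>G\<^esub>" "Cod C f' = fst Y' \<one>\<^bsub>G\<^esub>"
  shows "translate g (tensor_fam X X') (tensor_fam Y Y') (f \<otimes>\<^sub>a f') = translate g X Y f \<otimes>\<^sub>a translate g X' Y' f'"
proof (rule translate_unique)
  have nat: "psi C g (fst Y \<one>\<^bsub>G\<^esub>) (fst Y' \<one>\<^bsub>G\<^esub>) \<cdot> act_arr C g (f \<otimes>\<^sub>a f')
    = (act_arr C g f \<otimes>\<^sub>a act_arr C g f') \<cdot> psi C g (fst X \<one>\<^bsub>G\<^esub>) (fst X' \<one>\<^bsub>G\<^esub>)"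
    using psi_nat[OF g f(1) f'(1)] f f' by simp
  show "(translate g X Y f \<otimes>\<^sub>a translate g X' Y' f') \<cdot> snd (tensor_fam X X') g \<one>\<^bsub>G\<^esub>
    = snd (tensor_fam Y Y') g \<one>\<^bsub>G\<^esub> \<cdot> act_arr C g (f \<otimes>\<^sub>a f')"
    using XY g f f' by (simp add: nat)
qed (use assms in simp_all)

end

context graded_braiding
begin

lemma deg_in_Obj [simp]: "g \<in> carrier G \<Longrightarrow> X \<in> deg C g \<Longrightarrow> X \<in> Obj C"
  using deg_Obj by blast

lemma braid_simps [simp]:
  assumes "g \<in> carrier G" "X \<in> deg C g" "Y \<in> Obj C"
  shows "braid C g X Y \<in> Arr C" "Dom C (braid C g X Y) = X \<otimes>\<^sub>o Y"
    "Cod C (braid C g X Y) = act_obj C g Y \<otimes>\<^sub>o X" "is_iso C (braid C g X Y)"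
  using braid_iso[OF assms] by (auto simp: Hom_iff)

lemma braid_nat:
  assumes "g \<in> carrier G" "Dom C f \<in> deg C g" "Cod C f \<in> deg C g" "f \<in> Arr C" "f' \<in> Arr C"
  shows "braid C g (Cod C f) (Cod C f') \<cdot> (f \<otimes>\<^sub>a f') = (act_arr C g f' \<otimes>\<^sub>a f) \<cdot> braid C g (Dom C f) (Dom C f')"
  using braid_natural[OF assms(1-3), where f = f and f' = f' and Y = "Dom C f'" and Y' = "Cod C f'"] assms(4,5)
  by (simp add: Hom_iff)

lemma inv_mult_cancel: "\<lbrakk>k \<in> carrier G; x \<in> carrier G\<rbrakk> \<Longrightarrow> inv\<^bsub>G\<^esub> k \<otimes>\<^bsub>G\<^esub> (k \<otimes>\<^bsub>G\<^esub> x) = x"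
  by (simp flip: m_assoc)

text \<open>
  Of a homogeneous family of degree \<open>g\<close> every component is required to lie in the expected degree, not
  just the one at \<open>\<one>\<close>: in the linear case a component \<open>C\<^sub>g\<close> need not be closed under isomorphism, so the
  condition at \<open>\<one>\<close> would not be inherited by shifted families.  Here \<open>'a\<close>, \<open>'c\<close> and \<open>'d\<close> stand for
  group elements, objects and arrows.
\<close>

definition homogeneous :: "'a \<Rightarrow> ('a, 'c, 'd) family_obj \<Rightarrow> bool" where
  "homogeneous g X \<longleftrightarrow> equivariant X \<and> (\<forall>k \<in> carrier G. fst X k \<in> deg C (k \<otimes>\<^bsub>G\<^esub> g \<otimes>\<^bsub>G\<^esub> inv\<^bsub>G\<^esub> k))"

lemma homogeneous_deg [simp]:
  assumes "homogeneous g X" "g \<in> carrier G"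
  shows "equivariant X" "k \<in> carrier G \<Longrightarrow> fst X k \<in> deg C (k \<otimes>\<^bsub>G\<^esub> (g \<otimes>\<^bsub>G\<^esub> inv\<^bsub>G\<^esub> k))"
    "fst X \<one>\<^bsub>G\<^esub> \<in> deg C g"
proof -
  have "fst X \<one>\<^bsub>G\<^esub> \<in> deg C (\<one>\<^bsub>G\<^esub> \<otimes>\<^bsub>G\<^esub> g \<otimes>\<^bsub>G\<^esub> inv\<^bsub>G\<^esub> \<one>\<^bsub>G\<^esub>)"
    using assms one_closed unfolding homogeneous_def by blast
  then show "fst X \<one>\<^bsub>G\<^esub> \<in> deg C g" using assms by simp
  show "equivariant X" "k \<in> carrier G \<Longrightarrow> fst X k \<in> deg C (k \<otimes>\<^bsub>G\<^esub> (g \<otimes>\<^bsub>G\<^esub> inv\<^bsub>G\<^esub> k))"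
    using assms by (auto simp: homogeneous_def m_assoc)
qed

lemma homogeneous_unit: "homogeneous \<one>\<^bsub>G\<^esub> unit_fam"
  by (auto simp: homogeneous_def deg_unit)

lemma homogeneous_tensor:
  assumes "homogeneous g X" "homogeneous h Y" "g \<in> carrier G" "h \<in> carrier G"
  shows "homogeneous (g \<otimes>\<^bsub>G\<^esub> h) (tensor_fam X Y)"
proof -
  have "fst X k \<otimes>\<^sub>o fst Y k \<in> deg C (k \<otimes>\<^bsub>G\<^esub> (g \<otimes>\<^bsub>G\<^esub> h) \<otimes>\<^bsub>G\<^esub> inv\<^bsub>G\<^esub> k)" if k: "k \<in> carrier G" for k
  proof -
    have "(k \<otimes>\<^bsub>G\<^esub> (g \<otimes>\<^bsub>G\<^esub> inv\<^bsub>G\<^esub> k)) \<otimes>\<^bsub>G\<^esub> (k \<otimes>\<^bsub>G\<^esub> (h \<otimes>\<^bsub>G\<^esub> inv\<^bsub>G\<^esub> k)) = k \<otimes>\<^bsub>G\<^esub> (g \<otimes>\<^bsub>G\<^esub> h) \<otimes>\<^bsub>G\<^esub> inv\<^bsub>G\<^esub> k"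
      using assms k by (simp add: m_assoc inv_mult_cancel)
    then show ?thesis
      using deg_tensor[of "k \<otimes>\<^bsub>G\<^esub> (g \<otimes>\<^bsub>G\<^esub> inv\<^bsub>G\<^esub> k)" "k \<otimes>\<^bsub>G\<^esub> (h \<otimes>\<^bsub>G\<^esub> inv\<^bsub>G\<^esub> k)" "fst X k" "fst Y k"] assms k
      by simp
  qed
  then show ?thesis using assms by (simp add: homogeneous_def)
qed

lemma homogeneous_shift:
  assumes "homogeneous h X" "g \<in> carrier G" "h \<in> carrier G"
  shows "homogeneous (g \<otimes>\<^bsub>G\<^esub> h \<otimes>\<^bsub>G\<^esub> inv\<^bsub>G\<^esub> g) (shift_fam g X)"
proof -
  have "fst X (k \<otimes>\<^bsub>G\<^esub> g) \<in> deg C (k \<otimes>\<^bsub>G\<^esub> (g \<otimes>\<^bsub>G\<^esub> h \<otimes>\<^bsub>G\<^esub> inv\<^bsub>G\<^esub> g) \<otimes>\<^bsub>G\<^esub> inv\<^bsub>G\<^esub> k)" if "k \<in> carrier G" for k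
    using homogeneous_deg(2)[OF assms(1,3), of "k \<otimes>\<^bsub>G\<^esub> g"] assms that
    by (simp add: m_assoc inv_mult_group)
  then show ?thesis using assms by (simp add: homogeneous_def)
qed

lemma homogeneous_orbit: "g \<in> carrier G \<Longrightarrow> Z \<in> deg C g \<Longrightarrow> homogeneous g (orbit_fam Z)"
  by (auto simp: homogeneous_def deg_act)

text \<open>
  The component at \<open>\<one>\<close> of the braiding of families: the braiding of \<open>C\<close> ends in
  \<open>g\<^sub>*(Y\<^sub>1) \<otimes> X\<^sub>1\<close>, and the structure arrow replaces \<open>g\<^sub>*(Y\<^sub>1)\<close> by the component \<open>Y\<^sub>g\<close> of the shifted
  family.
\<close>

definition braid_fam :: "'a \<Rightarrow> ('a, 'c, 'd) family_obj \<Rightarrow> ('a, 'c, 'd) family_obj \<Rightarrow> 'd" where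
  "braid_fam g X Y = (snd Y g \<one>\<^bsub>G\<^esub> \<otimes>\<^sub>a \<iota> (fst X \<one>\<^bsub>G\<^esub>)) \<cdot> braid C g (fst X \<one>\<^bsub>G\<^esub>) (fst Y \<one>\<^bsub>G\<^esub>)"

lemma braid_fam_simps [simp]:
  assumes "g \<in> carrier G" "homogeneous g X" "equivariant Y"
  shows "braid_fam g X Y \<in> Arr C" "Dom C (braid_fam g X Y) = fst X \<one>\<^bsub>G\<^esub> \<otimes>\<^sub>o fst Y \<one>\<^bsub>G\<^esub>"
    "Cod C (braid_fam g X Y) = fst Y g \<otimes>\<^sub>o fst X \<one>\<^bsub>G\<^esub>" "is_iso C (braid_fam g X Y)"
  using assms by (simp_all add: braid_fam_def)

lemma braid_fam_natural:
  assumes g: "g \<in> carrier G" and X: "homogeneous g X" "homogeneous g X'" and Y: "equivariant Y" "equivariant Y'"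
    and f: "f \<in> Arr C" "Dom C f = fst X \<one>\<^bsub>G\<^esub>" "Cod C f = fst X' \<one>\<^bsub>G\<^esub>"
    and f': "f' \<in> Arr C" "Dom C f' = fst Y \<one>\<^bsub>G\<^esub>" "Cod C f' = fst Y' \<one>\<^bsub>G\<^esub>"
  shows "braid_fam g X' Y' \<cdot> (f \<otimes>\<^sub>a f') = (translate g Y Y' f' \<otimes>\<^sub>a f) \<cdot> braid_fam g X Y"
  using assms braid_nat[of g f f'] by (simp add: braid_fam_def)

lemma braid_fam_tensor_right:
  assumes g: "g \<in> carrier G" and X: "homogeneous g X" and Y: "equivariant Y" "equivariant Z"
  shows "braid_fam g X (tensor_fam Y Z)
    = (\<iota> (fst Y g) \<otimes>\<^sub>a braid_fam g X Z) \<cdot> (braid_fam g X Y \<otimes>\<^sub>a \<iota> (fst Z \<one>\<^bsub>G\<^esub>))"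
proof -
  let ?x = "fst X \<one>\<^bsub>G\<^esub>" and ?y = "fst Y \<one>\<^bsub>G\<^esub>" and ?z = "fst Z \<one>\<^bsub>G\<^esub>"
  have "braid_fam g X (tensor_fam Y Z) = (snd Y g \<one>\<^bsub>G\<^esub> \<otimes>\<^sub>a (snd Z g \<one>\<^bsub>G\<^esub> \<otimes>\<^sub>a \<iota> ?x))
      \<cdot> (psi C g ?y ?z \<otimes>\<^sub>a \<iota> ?x) \<cdot> braid C g ?x (?y \<otimes>\<^sub>o ?z)"
    using assms by (simp add: braid_fam_def flip: tensor_arr_assoc)
  also have "\<dots> = (snd Y g \<one>\<^bsub>G\<^esub> \<otimes>\<^sub>a (snd Z g \<one>\<^bsub>G\<^esub> \<otimes>\<^sub>a \<iota> ?x))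
      \<cdot> (\<iota> (act_obj C g ?y) \<otimes>\<^sub>a braid C g ?x ?z) \<cdot> (braid C g ?x ?y \<otimes>\<^sub>a \<iota> ?z)"
    using assms by (simp add: braid_tensor_right)
  also have "\<dots> = (\<iota> (fst Y g) \<otimes>\<^sub>a braid_fam g X Z) \<cdot> (snd Y g \<one>\<^bsub>G\<^esub> \<otimes>\<^sub>a \<iota> (?x \<otimes>\<^sub>o ?z))
      \<cdot> (braid C g ?x ?y \<otimes>\<^sub>a \<iota> ?z)"
    using assms by (simp add: braid_fam_def)
  also have "(snd Y g \<one>\<^bsub>G\<^esub> \<otimes>\<^sub>a \<iota> (?x \<otimes>\<^sub>o ?z)) \<cdot> (braid C g ?x ?y \<otimes>\<^sub>a \<iota> ?z) = braid_fam g X Y \<otimes>\<^sub>a \<iota> ?z"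
    using assms by (simp add: braid_fam_def flip: tensor_ident tensor_arr_assoc)
  finally show ?thesis .
qed

text \<open>
  The factor \<open>\<phi>(g,h)\<close> of the hexagon in \<open>C\<close> is absorbed by the cocycle condition for \<open>Z\<close>.
\<close>

lemma braid_fam_tensor_left:
  assumes gh: "g \<in> carrier G" "h \<in> carrier G" and X: "homogeneous g X" and Y: "homogeneous h Y" and Z: "equivariant Z"
  shows "braid_fam (g \<otimes>\<^bsub>G\<^esub> h) (tensor_fam X Y) Z
    = (braid_fam g X (shift_fam h Z) \<otimes>\<^sub>a \<iota> (fst Y \<one>\<^bsub>G\<^esub>)) \<cdot> (\<iota> (fst X \<one>\<^bsub>G\<^esub>) \<otimes>\<^sub>a braid_fam h Y Z)"
proof -
  let ?x = "fst X \<one>\<^bsub>G\<^esub>" and ?y = "fst Y \<one>\<^bsub>G\<^esub>" and ?z = "fst Z \<one>\<^bsub>G\<^esub>"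
  let ?s = "snd Z g h" and ?t = "snd Z h \<one>\<^bsub>G\<^esub>"
  have nat: "braid C g ?x (fst Z h) \<cdot> (\<iota> ?x \<otimes>\<^sub>a ?t) = (act_arr C g ?t \<otimes>\<^sub>a \<iota> ?x) \<cdot> braid C g ?x (act_obj C h ?z)"
    using braid_nat[of g "\<iota> ?x" ?t] assms by simp
  have "braid_fam (g \<otimes>\<^bsub>G\<^esub> h) (tensor_fam X Y) Z
    = ((?s \<cdot> act_arr C g ?t) \<otimes>\<^sub>a \<iota> (?x \<otimes>\<^sub>o ?y)) \<cdot> (phi C g h ?z \<otimes>\<^sub>a \<iota> (?x \<otimes>\<^sub>o ?y)) \<cdot> braid C (g \<otimes>\<^bsub>G\<^esub> h) (?x \<otimes>\<^sub>o ?y) ?z"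
    using assms deg_tensor[of g h ?x ?y] by (simp add: braid_fam_def cocycle)
  also have "\<dots> = ((?s \<cdot> act_arr C g ?t) \<otimes>\<^sub>a \<iota> (?x \<otimes>\<^sub>o ?y))
    \<cdot> (braid C g ?x (act_obj C h ?z) \<otimes>\<^sub>a \<iota> ?y) \<cdot> (\<iota> ?x \<otimes>\<^sub>a braid C h ?y ?z)"
    using assms by (simp add: braid_tensor_left)
  also have "\<dots> = (?s \<otimes>\<^sub>a \<iota> (?x \<otimes>\<^sub>o ?y)) \<cdot> (((act_arr C g ?t \<otimes>\<^sub>a \<iota> ?x) \<cdot> braid C g ?x (act_obj C h ?z)) \<otimes>\<^sub>a \<iota> ?y)
    \<cdot> (\<iota> ?x \<otimes>\<^sub>a braid C h ?y ?z)"
    using assms by (simp flip: tensor_ident tensor_arr_assoc)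
  also have "\<dots> = (braid_fam g X (shift_fam h Z) \<otimes>\<^sub>a \<iota> ?y) \<cdot> (\<iota> ?x \<otimes>\<^sub>a braid_fam h Y Z)"
  proof -
    have "\<iota> ?x \<otimes>\<^sub>a braid_fam h Y Z = ((\<iota> ?x \<otimes>\<^sub>a ?t) \<otimes>\<^sub>a \<iota> ?y) \<cdot> (\<iota> ?x \<otimes>\<^sub>a braid C h ?y ?z)"
      using assms by (simp add: braid_fam_def)
    moreover have "braid_fam g X (shift_fam h Z) = (?s \<otimes>\<^sub>a \<iota> ?x) \<cdot> braid C g ?x (fst Z h)"
      using assms by (simp add: braid_fam_def)
    ultimately show ?thesis
      unfolding nat[symmetric] using assms by (simp flip: tensor_ident tensor_arr_assoc)
  qed
  finally show ?thesis .
qed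

text \<open>
  The action preserves the braiding.  Both sides are compared after composition with the structure
  arrow of the tensor product.  With \<open>k = g h g\<^sup>-\<^sup>1\<close> one has \<open>kg = gh\<close>, so the structure arrow of \<open>Z\<close> at
  \<open>(gh, \<one>)\<close> has two factorisations, one through \<open>\<phi>(g,h)\<close> and one through \<open>\<phi>(k,g)\<close>; these are
  the two isomorphisms that occur in the equivariance axiom of the braiding of \<open>C\<close>.
\<close>

lemma translate_braid_fam:
  assumes gh: "g \<in> carrier G" "h \<in> carrier G" and X: "homogeneous h X" and Z: "equivariant Z"
  shows "translate g (tensor_fam X Z) (tensor_fam (shift_fam h Z) X) (braid_fam h X Z)
    = braid_fam (g \<otimes>\<^bsub>G\<^esub> h \<otimes>\<^bsub>G\<^esub> inv\<^bsub>G\<^esub> g) (shift_fam g X) (shift_fam g Z)"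
proof (rule translate_unique)
  let ?k = "g \<otimes>\<^bsub>G\<^esub> h \<otimes>\<^bsub>G\<^esub> inv\<^bsub>G\<^esub> g"
  let ?x = "fst X \<one>\<^bsub>G\<^esub>" and ?z = "fst Z \<one>\<^bsub>G\<^esub>"
  let ?s = "snd Z g h" and ?t = "snd Z h \<one>\<^bsub>G\<^esub>" and ?u = "snd X g \<one>\<^bsub>G\<^esub>" and ?v = "snd Z g \<one>\<^bsub>G\<^esub>"
  let ?c = "braid C ?k (act_obj C g ?x) (act_obj C g ?z) \<cdot> psi C g ?x ?z"
  have k: "?k \<in> carrier G" "?k \<otimes>\<^bsub>G\<^esub> g = g \<otimes>\<^bsub>G\<^esub> h" using gh by (simp_all add: m_assoc)
  have Xd: "homogeneous ?k (shift_fam g X)" using homogeneous_shift assms by blast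
  have xd: "?x \<in> deg C h" "act_obj C g ?x \<in> deg C ?k" "fst X g \<in> deg C ?k"
    using homogeneous_deg(3)[OF Xd k(1)] assms deg_act[of g h ?x] by simp_all
  show "braid_fam ?k (shift_fam g X) (shift_fam g Z) \<cdot> snd (tensor_fam X Z) g \<one>\<^bsub>G\<^esub>
    = snd (tensor_fam (shift_fam h Z) X) g \<one>\<^bsub>G\<^esub> \<cdot> act_arr C g (braid_fam h X Z)"
  proof -
    have "snd (tensor_fam (shift_fam h Z) X) g \<one>\<^bsub>G\<^esub> \<cdot> act_arr C g (braid_fam h X Z)
      = (?s \<otimes>\<^sub>a ?u) \<cdot> (psi C g (fst Z h) ?x \<cdot> act_arr C g (?t \<otimes>\<^sub>a \<iota> ?x)) \<cdot> act_arr C g (braid C h ?x ?z)"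
      using assms by (simp add: braid_fam_def)
    also have "\<dots> = (?s \<otimes>\<^sub>a ?u) \<cdot> ((act_arr C g ?t \<otimes>\<^sub>a \<iota> (act_obj C g ?x)) \<cdot> psi C g (act_obj C h ?z) ?x)
       \<cdot> act_arr C g (braid C h ?x ?z)"
      using psi_nat[of g ?t "\<iota> ?x"] assms by simp
    also have "\<dots> = ((?s \<cdot> act_arr C g ?t) \<otimes>\<^sub>a ?u) \<cdot> (psi C g (act_obj C h ?z) ?x \<cdot> act_arr C g (braid C h ?x ?z))"
      using assms by simp
    also have "\<dots> = ((?s \<cdot> act_arr C g ?t \<cdot> phi C g h ?z \<cdot> inv_arrow C (phi C ?k g ?z)) \<otimes>\<^sub>a ?u) \<cdot> ?c"
      using assms xd k by (simp add: braid_act)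
    also have "?s \<cdot> act_arr C g ?t \<cdot> phi C g h ?z \<cdot> inv_arrow C (phi C ?k g ?z)
       = snd Z (?k \<otimes>\<^bsub>G\<^esub> g) \<one>\<^bsub>G\<^esub> \<cdot> inv_arrow C (phi C ?k g ?z)"
      unfolding k(2) using assms k by (simp add: cocycle)
    also have "\<dots> = snd Z ?k g \<cdot> act_arr C ?k ?v"
      unfolding cocycle[OF Z k(1) gh(1) one_closed] using assms k by simp
    also have "((snd Z ?k g \<cdot> act_arr C ?k ?v) \<otimes>\<^sub>a ?u) \<cdot> ?c
      = (snd Z ?k g \<otimes>\<^sub>a \<iota> (fst X g)) \<cdot> ((act_arr C ?k ?v \<otimes>\<^sub>a ?u) \<cdot> braid C ?k (act_obj C g ?x) (act_obj C g ?z)) \<cdot> psi C g ?x ?z"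
      using assms k xd by simp
    also have "(act_arr C ?k ?v \<otimes>\<^sub>a ?u) \<cdot> braid C ?k (act_obj C g ?x) (act_obj C g ?z)
      = braid C ?k (fst X g) (fst Z g) \<cdot> (?u \<otimes>\<^sub>a ?v)"
      using braid_nat[of ?k ?u ?v] k xd assms by simp
    also have "(snd Z ?k g \<otimes>\<^sub>a \<iota> (fst X g)) \<cdot> (braid C ?k (fst X g) (fst Z g) \<cdot> (?u \<otimes>\<^sub>a ?v)) \<cdot> psi C g ?x ?z
      = braid_fam ?k (shift_fam g X) (shift_fam g Z) \<cdot> snd (tensor_fam X Z) g \<one>\<^bsub>G\<^esub>"
      using assms k xd by (simp add: braid_fam_def)
    finally show ?thesis ..
  qed
  show "braid_fam ?k (shift_fam g X) (shift_fam g Z) \<in> Arr C"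
    "Dom C (braid_fam ?k (shift_fam g X) (shift_fam g Z)) = fst (tensor_fam X Z) g"
    using Xd k assms by simp_all
qed (use assms in simp_all)

end

section \<open>The strictification\<close>

text \<open>
  An arrow of \<open>C\<close> labelled with the families between which it acts; one arrow of \<open>C\<close> gives rise to
  many arrows of the strictification.
\<close>

definition tagged :: "'p \<Rightarrow> 'p \<Rightarrow> 'm \<Rightarrow> 'p \<times> 'p \<times> ('g \<Rightarrow> 'm)" where
  "tagged X Y f = (X, Y, \<lambda>_. f)"

text \<open>
  The family in a tagged arrow is constant, so any index will do.
\<close>

definition untag :: "'p \<times> 'p \<times> ('g \<Rightarrow> 'm) \<Rightarrow> 'm" where
  "untag u = snd (snd u) undefined"

lemma tagged_simps [simp]:
  "fst (tagged X Y f) = X" "fst (snd (tagged X Y f)) = Y" "untag (tagged X Y f) = f"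
  by (simp_all add: tagged_def untag_def)

lemma tagged_inject [simp]: "tagged X Y f = tagged X' Y' f' \<longleftrightarrow> X = X' \<and> Y = Y' \<and> f = f'"
  by (auto simp: tagged_def fun_eq_iff)

context graded_braiding
begin

text \<open>
  Arrows between families are arrows between the components at \<open>\<one>\<close>, without an equivariance
  condition, since the other components are determined by that one.
\<close>

definition strictification :: "('a, 'c, 'd) family_category" where
  "strictification =
     \<lparr>Obj = {X. equivariant X},
      Arr = {tagged X Y f | X Y f. equivariant X \<and> equivariant Y \<and> f \<in> Hom C (fst X \<one>\<^bsub>G\<^esub>) (fst Y \<one>\<^bsub>G\<^esub>)},
      Dom = fst,
      Cod = (\<lambda>u. fst (snd u)),
      ident = (\<lambda>X. tagged X X (\<iota> (fst X \<one>\<^bsub>G\<^esub>))),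
      Comp = (\<lambda>v u. tagged (fst u) (fst (snd v)) (untag v \<cdot> untag u)),
      tensor_obj = tensor_fam,
      tensor_arr = (\<lambda>u v. tagged (tensor_fam (fst u) (fst v)) (tensor_fam (fst (snd u)) (fst (snd v)))
        (untag u \<otimes>\<^sub>a untag v)),
      unit_obj = unit_fam,
      act_obj = shift_fam,
      act_arr = (\<lambda>g u. tagged (shift_fam g (fst u)) (shift_fam g (fst (snd u)))
        (translate g (fst u) (fst (snd u)) (untag u))),
      phi = (\<lambda>g h X. tagged (shift_fam (g \<otimes>\<^bsub>G\<^esub> h) X) (shift_fam (g \<otimes>\<^bsub>G\<^esub> h) X)
        (\<iota> (fst (shift_fam (g \<otimes>\<^bsub>G\<^esub> h) X) \<one>\<^bsub>G\<^esub>))),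
      psi = (\<lambda>g X Y. tagged (shift_fam g (tensor_fam X Y)) (shift_fam g (tensor_fam X Y))
        (\<iota> (fst (shift_fam g (tensor_fam X Y)) \<one>\<^bsub>G\<^esub>))),
      deg = (\<lambda>g. {X. homogeneous g X}),
      braid = (\<lambda>g X Y. tagged (tensor_fam X Y) (tensor_fam (shift_fam g Y) X) (braid_fam g X Y))\<rparr>"

abbreviation "S \<equiv> strictification"

lemma S_simps [simp]:
  "Obj S = {X. equivariant X}"
  "Dom S (tagged X Y f) = X" "Cod S (tagged X Y f) = Y"
  "ident S X = tagged X X (\<iota> (fst X \<one>\<^bsub>G\<^esub>))"
  "tagged Y' Z f' \<cdot>\<^bsub>S\<^esub> tagged X Y f = tagged X Z (f' \<cdot> f)"
  "tensor_obj S = tensor_fam"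
  "tagged X Y f \<otimes>\<^sub>a\<^bsub>S\<^esub> tagged X' Y' f' = tagged (tensor_fam X X') (tensor_fam Y Y') (f \<otimes>\<^sub>a f')"
  "unit_obj S = unit_fam"
  "act_obj S = shift_fam"
  "act_arr S g (tagged X Y f) = tagged (shift_fam g X) (shift_fam g Y) (translate g X Y f)"
  "phi S g h X = tagged (shift_fam (g \<otimes>\<^bsub>G\<^esub> h) X) (shift_fam (g \<otimes>\<^bsub>G\<^esub> h) X)
        (\<iota> (fst (shift_fam (g \<otimes>\<^bsub>G\<^esub> h) X) \<one>\<^bsub>G\<^esub>))"
  "psi S g X Y = tagged (shift_fam g (tensor_fam X Y)) (shift_fam g (tensor_fam X Y))
        (\<iota> (fst (shift_fam g (tensor_fam X Y)) \<one>\<^bsub>G\<^esub>))"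
  "deg S g = {X. homogeneous g X}"
  "braid S g X Y = tagged (tensor_fam X Y) (tensor_fam (shift_fam g Y) X) (braid_fam g X Y)"
  by (simp_all add: strictification_def)

lemma tagged_Arr [simp]:
  "tagged X Y f \<in> Arr S \<longleftrightarrow> equivariant X \<and> equivariant Y
    \<and> f \<in> Arr C \<and> Dom C f = fst X \<one>\<^bsub>G\<^esub> \<and> Cod C f = fst Y \<one>\<^bsub>G\<^esub>"
  by (simp add: strictification_def Hom_iff del: split_paired_Ex)

lemma S_ArrE:
  assumes "u \<in> Arr S"
  obtains X Y f where "u = tagged X Y f" "equivariant X" "equivariant Y"
    "f \<in> Arr C" "Dom C f = fst X \<one>\<^bsub>G\<^esub>" "Cod C f = fst Y \<one>\<^bsub>G\<^esub>"
  using assms by (auto simp: strictification_def Hom_iff)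

lemma S_HomE:
  assumes "u \<in> Hom S X Y"
  obtains f where "u = tagged X Y f" "equivariant X" "equivariant Y"
    "f \<in> Arr C" "Dom C f = fst X \<one>\<^bsub>G\<^esub>" "Cod C f = fst Y \<one>\<^bsub>G\<^esub>"
  using assms by (auto simp: Hom_def elim: S_ArrE)

lemma tagged_Hom [simp]:
  "tagged X Y f \<in> Hom S X' Y' \<longleftrightarrow> X = X' \<and> Y = Y' \<and> equivariant X \<and> equivariant Y
    \<and> f \<in> Arr C \<and> Dom C f = fst X \<one>\<^bsub>G\<^esub> \<and> Cod C f = fst Y \<one>\<^bsub>G\<^esub>"
  by (auto simp: Hom_def)

lemma orbit_one [simp]: "Z \<in> Obj C \<Longrightarrow> fst (orbit_fam Z) \<one>\<^bsub>G\<^esub> = Z"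
  by (simp add: act_one_obj)

text \<open>
  Evaluation at \<open>\<one>\<close> is fully faithful by construction; it is surjective on objects because the orbit
  of \<open>Z\<close> has the component \<open>\<one>\<^sub>*(Z) = Z\<close>.
\<close>

lemma fully_faithful_cover_S: "fully_faithful_cover C S (\<lambda>X. fst X \<one>\<^bsub>G\<^esub>) untag tagged"
proof (intro fully_faithful_cover.intro fully_faithful_cover_axioms.intro category_axioms)
  have "Z \<in> (\<lambda>X. fst X \<one>\<^bsub>G\<^esub>) ` Obj S" if "Z \<in> Obj C" for Z
    using that by (intro image_eqI[of _ _ "orbit_fam Z"]) (simp_all add: act_one_obj)
  moreover have "fst X \<one>\<^bsub>G\<^esub> \<in> Obj C" if "X \<in> Obj S" for X
    using that by simp
  ultimately show "(\<lambda>X. fst X \<one>\<^bsub>G\<^esub>) ` Obj S = Obj C" by blast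
qed (auto simp: Hom_iff elim!: S_ArrE S_HomE)

lemmas category_S = fully_faithful_cover.category_D[OF fully_faithful_cover_S]

lemma is_iso_tagged:
  "\<lbrakk>equivariant X; equivariant Y; f \<in> Arr C; Dom C f = fst X \<one>\<^bsub>G\<^esub>; Cod C f = fst Y \<one>\<^bsub>G\<^esub>; is_iso C f\<rbrakk>
    \<Longrightarrow> is_iso S (tagged X Y f)"
  by (rule fully_faithful_cover.is_iso_D[OF fully_faithful_cover_S]) simp_all

lemma inv_tagged_ident:
  "equivariant X \<Longrightarrow> inv_arrow S (tagged X X (\<iota> (fst X \<one>\<^bsub>G\<^esub>))) = tagged X X (\<iota> (fst X \<one>\<^bsub>G\<^esub>))"
  using category.inv_ident[OF category_S, of X] by simp

lemma monoidal_category_S: "monoidal_category S"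
proof (intro monoidal_category.intro monoidal_category_axioms.intro category_S)
qed (auto elim!: S_HomE S_ArrE simp: tensor_fam_assoc tensor_fam_unit)

lemma monoidal_G_category_S: "monoidal_G_category G S"
proof (intro monoidal_G_category.intro monoidal_G_category_axioms.intro monoidal_category_S group_axioms)
  fix g assume g: "g \<in> carrier G"
  show "is_functor S S (act S g)"
    using g by (auto simp: is_functor_def act_def translate_ident translate_Comp elim!: S_ArrE)
  show "tensor_comparison S S (act S g) (psi S g)"
    unfolding tensor_comparison_def act_def
    by (intro conjI ballI; (elim S_ArrE)?)
      (use g in \<open>simp_all add: shift_fam_tensor tensor_fam_assoc translate_tensor is_iso_tagged\<close>)
next
  fix g h assume gh: "g \<in> carrier G" "h \<in> carrier G"
  show "natural_iso S S (act S (g \<otimes>\<^bsub>G\<^esub> h)) (comp_functor (act S g) (act S h)) (phi S g h)"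
    unfolding natural_iso_def act_def comp_functor_def
    by (intro conjI ballI; (elim S_ArrE)?)
      (use gh in \<open>simp_all add: shift_fam_mult translate_mult is_iso_tagged\<close>)
next
  fix f assume "f \<in> Arr S"
  then show "act_arr S \<one>\<^bsub>G\<^esub> f = f"
    by (auto simp: shift_fam_one translate_one elim!: S_ArrE)
next
  fix g h k X assume "g \<in> carrier G" "h \<in> carrier G" "k \<in> carrier G" "X \<in> Obj S"
  then show "phi S g h (act_obj S k X) \<cdot>\<^bsub>S\<^esub> phi S (g \<otimes>\<^bsub>G\<^esub> h) k X
            = act_arr S g (phi S h k X) \<cdot>\<^bsub>S\<^esub> phi S g (h \<otimes>\<^bsub>G\<^esub> k) X"
    using translate_ident[of "shift_fam (h \<otimes>\<^bsub>G\<^esub> k) X" g]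
    by (simp add: shift_fam_mult m_assoc)
next
  fix g h X Y assume "g \<in> carrier G" "h \<in> carrier G" "X \<in> Obj S" "Y \<in> Obj S"
  then show "(phi S g h X \<otimes>\<^sub>a\<^bsub>S\<^esub> phi S g h Y) \<cdot>\<^bsub>S\<^esub> psi S (g \<otimes>\<^bsub>G\<^esub> h) X Y
            = psi S g (act_obj S h X) (act_obj S h Y) \<cdot>\<^bsub>S\<^esub> act_arr S g (psi S h X Y)
                \<cdot>\<^bsub>S\<^esub> phi S g h (X \<otimes>\<^sub>o\<^bsub>S\<^esub> Y)"
    using translate_ident[of "shift_fam h (tensor_fam X Y)" g]
    by (simp add: shift_fam_mult shift_fam_tensor m_assoc)
qed (auto simp: shift_fam_unit shift_fam_one shift_fam_tensor tensor_fam_unit)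

lemma strict_S: "strict_action G S"
  by (simp add: strict_action_def)

lemma graded_braiding_S: "graded_braiding G S"
proof (intro graded_braiding.intro graded_braiding_axioms.intro monoidal_G_category_S)
  fix g h X Z assume gh: "g \<in> carrier G" "h \<in> carrier G" and "X \<in> deg S h" "Z \<in> Obj S"
  then have XZ: "homogeneous h X" "equivariant X" "equivariant Z" by simp_all
  let ?k = "g \<otimes>\<^bsub>G\<^esub> h \<otimes>\<^bsub>G\<^esub> inv\<^bsub>G\<^esub> g"
  have k: "?k \<in> carrier G" "?k \<otimes>\<^bsub>G\<^esub> g = g \<otimes>\<^bsub>G\<^esub> h" using gh by (simp_all add: m_assoc)
  have Xg: "homogeneous ?k (shift_fam g X)" using homogeneous_shift XZ gh by blast
  show "psi S g (act_obj S h Z) X \<cdot>\<^bsub>S\<^esub> act_arr S g (braid S h X Z)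
            = (phi S g h Z \<otimes>\<^sub>a\<^bsub>S\<^esub> ident S (act_obj S g X))
              \<cdot>\<^bsub>S\<^esub> (inv_arrow S (phi S ?k g Z) \<otimes>\<^sub>a\<^bsub>S\<^esub> ident S (act_obj S g X))
              \<cdot>\<^bsub>S\<^esub> braid S ?k (act_obj S g X) (act_obj S g Z)
              \<cdot>\<^bsub>S\<^esub> psi S g X Z"
    using gh XZ k Xg translate_braid_fam[OF gh XZ(1,3)]
      inv_tagged_ident[of "shift_fam (g \<otimes>\<^bsub>G\<^esub> h) Z"]
    by (simp add: k(2) shift_fam_mult shift_fam_tensor)
next
  fix g X X' Y Y' f f'
  assume "g \<in> carrier G" "X \<in> deg S g" "X' \<in> deg S g" "f \<in> Hom S X X'" "f' \<in> Hom S Y Y'"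
  then show "braid S g X' Y' \<cdot>\<^bsub>S\<^esub> (f \<otimes>\<^sub>a\<^bsub>S\<^esub> f') = (act_arr S g f' \<otimes>\<^sub>a\<^bsub>S\<^esub> f) \<cdot>\<^bsub>S\<^esub> braid S g X Y"
    by (auto elim!: S_HomE simp: braid_fam_natural)
next
  fix g X Y Z assume "g \<in> carrier G" "X \<in> deg S g" "Y \<in> Obj S" "Z \<in> Obj S"
  then show "(psi S g Y Z \<otimes>\<^sub>a\<^bsub>S\<^esub> ident S X) \<cdot>\<^bsub>S\<^esub> braid S g X (Y \<otimes>\<^sub>o\<^bsub>S\<^esub> Z)
            = (ident S (act_obj S g Y) \<otimes>\<^sub>a\<^bsub>S\<^esub> braid S g X Z) \<cdot>\<^bsub>S\<^esub> (braid S g X Y \<otimes>\<^sub>a\<^bsub>S\<^esub> ident S Z)"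
    using braid_fam_simps[of g X "tensor_fam Y Z"]
    by (simp add: braid_fam_tensor_right[symmetric] tensor_fam_assoc shift_fam_tensor)
next
  fix g h X Y Z assume "g \<in> carrier G" "h \<in> carrier G" "X \<in> deg S g" "Y \<in> deg S h" "Z \<in> Obj S"
  then show "(phi S g h Z \<otimes>\<^sub>a\<^bsub>S\<^esub> ident S (X \<otimes>\<^sub>o\<^bsub>S\<^esub> Y)) \<cdot>\<^bsub>S\<^esub> braid S (g \<otimes>\<^bsub>G\<^esub> h) (X \<otimes>\<^sub>o\<^bsub>S\<^esub> Y) Z
            = (braid S g X (act_obj S h Z) \<otimes>\<^sub>a\<^bsub>S\<^esub> ident S Y) \<cdot>\<^bsub>S\<^esub> (ident S X \<otimes>\<^sub>a\<^bsub>S\<^esub> braid S h Y Z)"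
    using braid_fam_simps[of "g \<otimes>\<^bsub>G\<^esub> h" "tensor_fam X Y" Z] homogeneous_tensor[of g X h Y]
    by (simp add: braid_fam_tensor_left[symmetric] tensor_fam_assoc shift_fam_mult)
qed (auto simp: homogeneous_unit homogeneous_tensor homogeneous_shift intro!: is_iso_tagged)

end

section \<open>The grading of the strictification\<close>

context graded_braiding
begin

text \<open>
  In a disjoint union of categories degrees are invariant under isomorphism, and the structure arrow
  \<open>k\<^sub>*(X\<^sub>1) \<rightarrow> X\<^sub>k\<close> transports the degree of the component at \<open>\<one>\<close> to all others.
\<close>

lemma homogeneous_if_one:
  assumes C: "coproduct_decomposition G C" and X: "equivariant X" and g: "g \<in> carrier G" "fst X \<one>\<^bsub>G\<^esub> \<in> deg C g"
  shows "homogeneous g X"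
  unfolding homogeneous_def
proof (intro conjI ballI X)
  fix k assume k: "k \<in> carrier G"
  let ?k = "k \<otimes>\<^bsub>G\<^esub> g \<otimes>\<^bsub>G\<^esub> inv\<^bsub>G\<^esub> k"
  have "snd X k \<one>\<^bsub>G\<^esub> \<in> Arr C" using X k by simp
  then obtain h where h: "h \<in> carrier G" "Dom C (snd X k \<one>\<^bsub>G\<^esub>) \<in> deg C h" "Cod C (snd X k \<one>\<^bsub>G\<^esub>) \<in> deg C h"
    using C unfolding coproduct_decomposition_def by blast
  have "act_obj C k (fst X \<one>\<^bsub>G\<^esub>) \<in> deg C h" "fst X k \<in> deg C h" using h X k by simp_all
  moreover have "act_obj C k (fst X \<one>\<^bsub>G\<^esub>) \<in> deg C ?k" using deg_act k g by simp
  moreover have "?k \<in> carrier G" using k g by simp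
  ultimately show "fst X k \<in> deg C ?k"
    using C h(1) unfolding coproduct_decomposition_def by (metis IntI empty_iff)
qed

lemma coproduct_decomposition_S:
  assumes C: "coproduct_decomposition G C"
  shows "coproduct_decomposition G S"
  unfolding coproduct_decomposition_def
proof (intro conjI ballI impI)
  have "\<exists>g \<in> carrier G. homogeneous g X" if X: "equivariant X" for X
  proof -
    have "fst X \<one>\<^bsub>G\<^esub> \<in> Obj C" using X by simp
    then obtain g where "g \<in> carrier G" "fst X \<one>\<^bsub>G\<^esub> \<in> deg C g"
      using C unfolding coproduct_decomposition_def by blast
    then show ?thesis using homogeneous_if_one[OF C X] by blast
  qed
  then show "(\<Union>g \<in> carrier G. deg S g) = Obj S" by (auto simp: homogeneous_def)
next
  fix g h assume gh: "g \<in> carrier G" "h \<in> carrier G" "g \<noteq> h"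
  then have "deg C g \<inter> deg C h = {}" using C unfolding coproduct_decomposition_def by blast
  then show "deg S g \<inter> deg S h = {}" using homogeneous_deg(3) gh by fastforce
next
  fix u assume "u \<in> Arr S"
  then obtain X Y f where u: "u = tagged X Y f" "equivariant X" "equivariant Y"
    "f \<in> Arr C" "Dom C f = fst X \<one>\<^bsub>G\<^esub>" "Cod C f = fst Y \<one>\<^bsub>G\<^esub>" by (rule S_ArrE)
  then obtain g where "g \<in> carrier G" "Dom C f \<in> deg C g" "Cod C f \<in> deg C g"
    using C unfolding coproduct_decomposition_def by blast
  then show "\<exists>g \<in> carrier G. Dom S u \<in> deg S g \<and> Cod S u \<in> deg S g"
    using u homogeneous_if_one[OF C] by (intro bexI[of _ g]) simp_all
qed

section \<open>The linear structure of the strictification\<close>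

abbreviation "HS \<equiv> pull_module (\<lambda>X. fst X \<one>\<^bsub>G\<^esub>) untag tagged"

lemma HS_tagged:
  "tagged X Y f \<oplus>\<^bsub>HS H X Y\<^esub> tagged X Y f' = tagged X Y (f \<oplus>\<^bsub>H (fst X \<one>\<^bsub>G\<^esub>) (fst Y \<one>\<^bsub>G\<^esub>)\<^esub> f')"
  "a \<odot>\<^bsub>HS H X Y\<^esub> tagged X Y f = tagged X Y (a \<odot>\<^bsub>H (fst X \<one>\<^bsub>G\<^esub>) (fst Y \<one>\<^bsub>G\<^esub>)\<^esub> f)"
  by (simp_all add: pull_module_simps)

text \<open>
  Every object of \<open>C\<^sub>g\<close> is the component at \<open>\<one>\<close> of a homogeneous family, namely of its orbit.
  Evaluation thus covers the component of degree \<open>g\<close>, and a decomposition of \<open>X\<^sub>1\<close> lifts to one of \<open>X\<close>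
  into orbits.
\<close>

lemma linear_coproduct_decomposition_S:
  assumes lin: "linear_category k C H" and C: "linear_coproduct_decomposition G k C H"
  shows "linear_coproduct_decomposition G k S (HS H)"
  unfolding linear_coproduct_decomposition_def
proof (intro conjI ballI impI)
  fix g assume g: "g \<in> carrier G"
  show "deg S g \<subseteq> Obj S" by (auto simp: homogeneous_def)
  moreover have "(\<lambda>X. fst X \<one>\<^bsub>G\<^esub>) ` deg S g = deg C g"
  proof (intro equalityI subsetI)
    fix Z assume "Z \<in> deg C g"
    then show "Z \<in> (\<lambda>X. fst X \<one>\<^bsub>G\<^esub>) ` deg S g"
      using g homogeneous_orbit by (intro image_eqI[of _ _ "orbit_fam Z"]) (simp_all add: act_one_obj)
  next
    fix Z assume "Z \<in> (\<lambda>X. fst X \<one>\<^bsub>G\<^esub>) ` deg S g"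
    then obtain X where "homogeneous g X" "Z = fst X \<one>\<^bsub>G\<^esub>" unfolding image_iff by auto
    then show "Z \<in> deg C g" using g by simp
  qed
  ultimately have "fully_faithful_cover (full_subcat C (deg C g)) (full_subcat S (deg S g)) (\<lambda>X. fst X \<one>\<^bsub>G\<^esub>) untag tagged"
    by (rule fully_faithful_cover.cover_full_subcat[OF fully_faithful_cover_S])
  moreover have "linear_abelian_category k (full_subcat C (deg C g)) H"
    using C g by (simp add: linear_coproduct_decomposition_def)
  ultimately show "linear_abelian_category k (full_subcat S (deg S g)) (HS H)"
    by (rule fully_faithful_cover.linear_abelian_category_D)
next
  fix g h X Y assume gh: "g \<in> carrier G" "h \<in> carrier G" "g \<noteq> h" and "X \<in> deg S g" "Y \<in> deg S h"
  then have XY: "homogeneous g X" "homogeneous h Y" by simp_all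
  then have "Hom C (fst X \<one>\<^bsub>G\<^esub>) (fst Y \<one>\<^bsub>G\<^esub>) = {\<zero>\<^bsub>H (fst X \<one>\<^bsub>G\<^esub>) (fst Y \<one>\<^bsub>G\<^esub>)\<^esub>}"
    using C gh homogeneous_deg(3) unfolding linear_coproduct_decomposition_def by blast
  moreover have "carrier (HS H X Y) = Hom S X Y"
    using XY gh by (intro fully_faithful_cover.carrier_pull[OF fully_faithful_cover_S lin]) simp_all
  moreover have "carrier (H (fst X \<one>\<^bsub>G\<^esub>) (fst Y \<one>\<^bsub>G\<^esub>)) = Hom C (fst X \<one>\<^bsub>G\<^esub>) (fst Y \<one>\<^bsub>G\<^esub>)"
    using XY gh by (intro linear_category.carrier_Hom[OF lin]) simp_all
  ultimately show "Hom S X Y = {\<zero>\<^bsub>HS H X Y\<^esub>}"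
    by (simp add: pull_module_simps)
next
  fix X assume "X \<in> Obj S"
  then have X: "equivariant X" by simp
  then obtain I Y where I: "I \<subseteq> carrier G" and Y: "\<And>g. g \<in> I \<Longrightarrow> Y g \<in> deg C g"
    and sum: "direct_sum C H I Y (fst X \<one>\<^bsub>G\<^esub>)"
    using C equivariant_simps(1)[OF X one_closed] unfolding linear_coproduct_decomposition_def
    by metis
  have YObj: "Y g \<in> Obj C" if "g \<in> I" for g
    by (rule deg_in_Obj[of g]) (use I Y that in auto)
  have sum': "direct_sum C H I (\<lambda>i. fst (orbit_fam (Y i)) \<one>\<^bsub>G\<^esub>) (fst X \<one>\<^bsub>G\<^esub>)"
    using sum by (subst direct_sum_cong[of I _ Y]) (simp_all add: YObj act_one_obj)
  have "direct_sum S (HS H) I (\<lambda>g. orbit_fam (Y g)) X"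
    using X YObj by (intro fully_faithful_cover.direct_sum_D[OF fully_faithful_cover_S lin _ _ sum']) auto
  then show "\<exists>I Y. I \<subseteq> carrier G \<and> (\<forall>g \<in> I. Y g \<in> deg S g) \<and> direct_sum S (HS H) I Y X"
    using I Y homogeneous_orbit by (intro exI[of _ I] exI[of _ "\<lambda>g. orbit_fam (Y g)"]) auto
qed

lemma bilinear_tensor_S:
  assumes bilinear: "bilinear_tensor k C H"
  shows "bilinear_tensor k S (HS H)"
  unfolding bilinear_tensor_def
proof (intro ballI)
  fix X X' Y Y' u v
  assume "u \<in> Hom S X X'" "v \<in> Hom S Y Y'"
  then obtain f g where uv: "u = tagged X X' f" "v = tagged Y Y' g"
    and X: "equivariant X" "equivariant X'" "equivariant Y" "equivariant Y'"
    and f: "f \<in> Hom C (fst X \<one>\<^bsub>G\<^esub>) (fst X' \<one>\<^bsub>G\<^esub>)" "g \<in> Hom C (fst Y \<one>\<^bsub>G\<^esub>) (fst Y' \<one>\<^bsub>G\<^esub>)"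
    by (auto simp: Hom_iff elim!: S_HomE)
  note bil = bilinear[unfolded bilinear_tensor_def, rule_format,
      OF equivariant_simps(1)[OF X(1) one_closed] equivariant_simps(1)[OF X(2) one_closed]
         equivariant_simps(1)[OF X(3) one_closed] equivariant_simps(1)[OF X(4) one_closed] f]
  show "(\<forall>u' \<in> Hom S X X'. (u \<oplus>\<^bsub>HS H X X'\<^esub> u') \<otimes>\<^sub>a\<^bsub>S\<^esub> v
           = (u \<otimes>\<^sub>a\<^bsub>S\<^esub> v) \<oplus>\<^bsub>HS H (X \<otimes>\<^sub>o\<^bsub>S\<^esub> Y) (X' \<otimes>\<^sub>o\<^bsub>S\<^esub> Y')\<^esub> (u' \<otimes>\<^sub>a\<^bsub>S\<^esub> v))
        \<and> (\<forall>v' \<in> Hom S Y Y'. u \<otimes>\<^sub>a\<^bsub>S\<^esub> (v \<oplus>\<^bsub>HS H Y Y'\<^esub> v')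
           = (u \<otimes>\<^sub>a\<^bsub>S\<^esub> v) \<oplus>\<^bsub>HS H (X \<otimes>\<^sub>o\<^bsub>S\<^esub> Y) (X' \<otimes>\<^sub>o\<^bsub>S\<^esub> Y')\<^esub> (u \<otimes>\<^sub>a\<^bsub>S\<^esub> v'))
        \<and> (\<forall>a \<in> carrier k.
             (a \<odot>\<^bsub>HS H X X'\<^esub> u) \<otimes>\<^sub>a\<^bsub>S\<^esub> v = a \<odot>\<^bsub>HS H (X \<otimes>\<^sub>o\<^bsub>S\<^esub> Y) (X' \<otimes>\<^sub>o\<^bsub>S\<^esub> Y')\<^esub> (u \<otimes>\<^sub>a\<^bsub>S\<^esub> v)
             \<and> u \<otimes>\<^sub>a\<^bsub>S\<^esub> (a \<odot>\<^bsub>HS H Y Y'\<^esub> v) = a \<odot>\<^bsub>HS H (X \<otimes>\<^sub>o\<^bsub>S\<^esub> Y) (X' \<otimes>\<^sub>o\<^bsub>S\<^esub> Y')\<^esub> (u \<otimes>\<^sub>a\<^bsub>S\<^esub> v))"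
    unfolding uv using bil by (auto simp: HS_tagged Hom_iff elim!: S_HomE)
qed

lemma linear_action_S:
  assumes lin: "linear_category k C H" and act: "linear_action G k C H"
  shows "linear_action G k S (HS H)"
  unfolding linear_action_def linear_functor_def
proof (intro ballI conjI)
  interpret L: linear_category k C H by (rule lin)
  fix g X Y u assume g: "g \<in> carrier G" and "u \<in> Hom S X Y"
  then obtain f where u: "u = tagged X Y f" and XY: "equivariant X" "equivariant Y"
    and f: "f \<in> Arr C" "Dom C f = fst X \<one>\<^bsub>G\<^esub>" "Cod C f = fst Y \<one>\<^bsub>G\<^esub>"
    by (auto elim!: S_HomE)
  let ?x = "fst X \<one>\<^bsub>G\<^esub>" and ?y = "fst Y \<one>\<^bsub>G\<^esub>"
  let ?r = "inv_arrow C (snd X g \<one>\<^bsub>G\<^esub>)" and ?s = "snd Y g \<one>\<^bsub>G\<^esub>"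
  have lin_g: "linear_functor k C H H (act C g)"
    using act g by (simp add: linear_action_def)
  have xy: "?x \<in> Obj C" "?y \<in> Obj C" using XY by simp_all
  have rs: "?r \<in> Hom C (fst X g) (act_obj C g ?x)" "?s \<in> Hom C (act_obj C g ?y) (fst Y g)"
    using XY g by (simp_all add: Hom_iff)
  have gf: "act_arr C g w \<in> Hom C (act_obj C g ?x) (act_obj C g ?y)" if "w \<in> Hom C ?x ?y" for w
    using that g by (simp add: Hom_iff)
  show "FArr (act S g) (u \<oplus>\<^bsub>HS H X Y\<^esub> v)
      = FArr (act S g) u \<oplus>\<^bsub>HS H (FObj (act S g) X) (FObj (act S g) Y)\<^esub> FArr (act S g) v"
    if "v \<in> Hom S X Y" for v
  proof -
    obtain f' where v: "v = tagged X Y f'" and f': "f' \<in> Arr C" "Dom C f' = ?x" "Cod C f' = ?y"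
      using \<open>v \<in> Hom S X Y\<close> by (auto elim!: S_HomE)
    have ff': "f \<in> Hom C ?x ?y" "f' \<in> Hom C ?x ?y" using f f' by (simp_all add: Hom_iff)
    have "act_arr C g (f \<oplus>\<^bsub>H ?x ?y\<^esub> f') = act_arr C g f \<oplus>\<^bsub>H (act_obj C g ?x) (act_obj C g ?y)\<^esub> act_arr C g f'"
      using lin_g xy ff' unfolding linear_functor_def by (simp add: act_def)
    then have "translate g X Y (f \<oplus>\<^bsub>H ?x ?y\<^esub> f')
      = translate g X Y f \<oplus>\<^bsub>H (fst X g) (fst Y g)\<^esub> translate g X Y f'"
      unfolding translate_def
      using L.Comp_add_left[OF rs(1) gf[OF ff'(1)] gf[OF ff'(2)]]
        L.Comp_add_right[OF Comp_in_Hom[OF rs(1) gf[OF ff'(1)]] Comp_in_Hom[OF rs(1) gf[OF ff'(2)]] rs(2)] by simp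
    then show ?thesis
      unfolding u v using g by (simp add: act_def HS_tagged)
  qed
  show "FArr (act S g) (a \<odot>\<^bsub>HS H X Y\<^esub> u) = a \<odot>\<^bsub>HS H (FObj (act S g) X) (FObj (act S g) Y)\<^esub> FArr (act S g) u"
    if a: "a \<in> carrier k" for a
  proof -
    have ff': "f \<in> Hom C ?x ?y" using f by (simp_all add: Hom_iff)
    have "act_arr C g (a \<odot>\<^bsub>H ?x ?y\<^esub> f) = a \<odot>\<^bsub>H (act_obj C g ?x) (act_obj C g ?y)\<^esub> act_arr C g f"
      using lin_g xy ff' a unfolding linear_functor_def by (simp add: act_def)
    then have "translate g X Y (a \<odot>\<^bsub>H ?x ?y\<^esub> f) = a \<odot>\<^bsub>H (fst X g) (fst Y g)\<^esub> translate g X Y f"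
      unfolding translate_def
      using L.Comp_smult_left[OF a rs(1) gf[OF ff']]
        L.Comp_smult_right[OF a Comp_in_Hom[OF rs(1) gf[OF ff']] rs(2)] by simp
    then show ?thesis
      unfolding u using g by (simp add: act_def HS_tagged)
  qed
qed

section \<open>The comparison functor\<close>

text \<open>
  Since \<open>\<one>\<^sub>*\<close> is the identity functor, the source and target families of \<open>F\<^sub>2\<close>, \<open>F\<^sub>0\<close> and \<open>\<eta>\<close> have
  the same component at \<open>\<one>\<close>, and all these arrows can be taken to be identities of \<open>C\<close>.  The constraints
  \<open>\<phi>\<close> and \<open>\<psi>\<close> are carried by the structure arrows of the orbits.
\<close>

definition orbit_functor ::
  "('c, 'd, ('a, 'c, 'd) family_obj, ('a, 'c, 'd) family_arr) mon_Functor" where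
  "orbit_functor =
     \<lparr>FObj = orbit_fam,
      FArr = (\<lambda>f. tagged (orbit_fam (Dom C f)) (orbit_fam (Cod C f)) f),
      F2 = (\<lambda>X Y. tagged (orbit_fam (X \<otimes>\<^sub>o Y)) (tensor_fam (orbit_fam X) (orbit_fam Y)) (\<iota> (X \<otimes>\<^sub>o Y))),
      F0 = tagged (orbit_fam \<I>) unit_fam (\<iota> \<I>)\<rparr>"

definition orbit_eta :: "'a \<Rightarrow> 'c \<Rightarrow> ('a, 'c, 'd) family_arr" where
  "orbit_eta g X = tagged (shift_fam g (orbit_fam X)) (orbit_fam (act_obj C g X)) (\<iota> (act_obj C g X))"

lemma orbit_functor_simps [simp]:
  "FObj orbit_functor = orbit_fam"
  "FArr orbit_functor f = tagged (orbit_fam (Dom C f)) (orbit_fam (Cod C f)) f"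
  "F2 orbit_functor X Y = tagged (orbit_fam (X \<otimes>\<^sub>o Y)) (tensor_fam (orbit_fam X) (orbit_fam Y)) (\<iota> (X \<otimes>\<^sub>o Y))"
  "F0 orbit_functor = tagged (orbit_fam \<I>) unit_fam (\<iota> \<I>)"
  by (simp_all add: orbit_functor_def)

lemma is_functor_orbit: "is_functor C S orbit_functor"
  by (auto simp: is_functor_def act_one_obj)

lemma is_equivalence_orbit: "is_equivalence C S orbit_functor"
  by (rule fully_faithful_cover.is_equivalence_section[OF fully_faithful_cover_S is_functor_orbit])
     (simp_all add: act_one_obj)

lemma monoidal_functor_orbit: "monoidal_functor C S orbit_functor"
  unfolding monoidal_functor_def tensor_comparison_def
  using is_functor_orbit
  by (auto simp: act_one_obj tensor_fam_assoc tensor_fam_unit intro!: is_iso_tagged)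

text \<open>
  An arrow between different families that is an identity of \<open>C\<close> at \<open>\<one>\<close> need not be one after the
  shift by \<open>g\<close>: for \<open>F\<^sub>2\<close> the shifted arrow is \<open>\<psi>\<^sup>g(X,Y)\<close>, and for \<open>\<eta>(h)\<close> it is \<open>\<phi>(g,h)\<^sub>X\<close>.  These are the terms
  which the two compatibility conditions ask for.
\<close>

lemma monoidal_G_functor_orbit: "monoidal_G_functor G C S orbit_functor orbit_eta"
  unfolding monoidal_G_functor_def
proof (intro conjI ballI monoidal_functor_orbit)
  fix g assume g: "g \<in> carrier G"
  show "monoidal_natural_iso C S (comp_mon_functor S (act S g) orbit_functor)
      (comp_mon_functor S orbit_functor (act C g)) (orbit_eta g)"
    unfolding monoidal_natural_iso_def natural_iso_def comp_mon_functor_def act_def orbit_eta_def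
    using g by (auto simp: act_one_obj act_unit phi_one_right psi_unit_right translate_def shift_fam_tensor shift_fam_unit
        intro!: is_iso_tagged)
next
  fix X assume "X \<in> Obj C"
  then show "orbit_eta \<one>\<^bsub>G\<^esub> X = ident S (FObj orbit_functor X)"
    by (simp add: orbit_eta_def shift_fam_one act_one_obj)
next
  fix g h X assume ghX: "g \<in> carrier G" "h \<in> carrier G" "X \<in> Obj C"
  then have "translate g (shift_fam h (orbit_fam X)) (orbit_fam (act_obj C h X)) (\<iota> (act_obj C h X)) = phi C g h X"
    by (intro translate_unique) (simp_all add: act_one_obj phi_one_right)
  with ghX show "FArr orbit_functor (phi C g h X) \<cdot>\<^bsub>S\<^esub> orbit_eta (g \<otimes>\<^bsub>G\<^esub> h) X
          = orbit_eta g (act_obj C h X) \<cdot>\<^bsub>S\<^esub> act_arr S g (orbit_eta h X) \<cdot>\<^bsub>S\<^esub> phi S g h (FObj orbit_functor X)"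
    by (simp add: orbit_eta_def shift_fam_mult)
qed

lemma braided_orbit: "braided_G_crossed_equivalence G C S orbit_functor orbit_eta"
  unfolding braided_G_crossed_equivalence_def braided_G_crossed_functor_def
  using monoidal_G_functor_orbit is_equivalence_orbit homogeneous_orbit
  by (auto simp: orbit_eta_def braid_fam_def act_one_obj phi_one_right)

lemma linear_functor_orbit:
  assumes "linear_category k C H"
  shows "linear_functor k C H (HS H) orbit_functor"
proof -
  interpret L: linear_category k C H by fact
  show ?thesis
    by (auto simp: linear_functor_def Hom_iff HS_tagged act_one_obj)
qed

end

theorem theorem5p6:
  fixes G :: "('g, 'x) monoid_scheme"
    and k :: "('k, 'y) ring_scheme"
    and C :: "('g, 'o, 'm) crossed_category"
    and H :: "'o \<Rightarrow> 'o \<Rightarrow> ('k, 'm) module"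
  assumes "group G"
  shows
    "(braided_G_crossed_category G C \<longrightarrow>
       (\<exists>(D :: ('g, 'o, 'm) family_category) F \<eta>.
          braided_G_crossed_category G D \<and> strict_action G D
          \<and> braided_G_crossed_equivalence G C D F \<eta>))
     \<and>
     (linear_braided_G_crossed_category G k C H \<longrightarrow>
       (\<exists>(D :: ('g, 'o, 'm) family_category) H' F \<eta>.
          linear_braided_G_crossed_category G k D H' \<and> strict_action G D
          \<and> braided_G_crossed_equivalence G C D F \<eta>
          \<and> linear_functor k C H H' F
          \<and> (bilinear_tensor k C H \<longrightarrow> bilinear_tensor k D H')
          \<and> (linear_action G k C H \<longrightarrow> linear_action G k D H')))"
proof (intro conjI impI)
  assume "braided_G_crossed_category G C"
  then interpret braided_G_crossed_category G C .
  have "braided_G_crossed_category G S"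
    using graded_braiding_S coproduct_decomposition_S[OF coproduct]
    by (intro braided_G_crossed_category.intro braided_G_crossed_category_axioms.intro)
  then show "\<exists>(D :: ('g, 'o, 'm) family_category) F \<eta>.
          braided_G_crossed_category G D \<and> strict_action G D
          \<and> braided_G_crossed_equivalence G C D F \<eta>"
    using strict_S braided_orbit by blast
next
  assume "linear_braided_G_crossed_category G k C H"
  then interpret linear_braided_G_crossed_category G k C H .
  note lin = linear_category_axioms
  have "linear_abelian_category k S (HS H)"
    by (rule fully_faithful_cover.linear_abelian_category_D[OF fully_faithful_cover_S linear_abelian_category_axioms])
  then have "linear_braided_G_crossed_category G k S (HS H)"
    using graded_braiding_S linear_coproduct_decomposition_S[OF lin coproduct]
    by (intro linear_braided_G_crossed_category.intro linear_braided_G_crossed_category_axioms.intro)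
  then show "\<exists>(D :: ('g, 'o, 'm) family_category) H' F \<eta>.
          linear_braided_G_crossed_category G k D H' \<and> strict_action G D
          \<and> braided_G_crossed_equivalence G C D F \<eta>
          \<and> linear_functor k C H H' F
          \<and> (bilinear_tensor k C H \<longrightarrow> bilinear_tensor k D H')
          \<and> (linear_action G k C H \<longrightarrow> linear_action G k D H')"
    using strict_S braided_orbit linear_functor_orbit[OF lin] bilinear_tensor_S linear_action_S[OF lin]
    by blast
qed

end
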